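(* Let $(f(n))_{n\ge 0}$ be a complex time series such that the autocovariance $\rho_s$ exists for all $s\in\mathbb{N}$. Let $\{v_i\}$ be the unit-length eigenvectors of the time shift operator $\mathcal{K}$ on $\mathcal{H}_f$ (one for each eigenvalue), and write $f=\sum_{i=1}^{\infty}a_iv_i+f_{sc}+f_{ac}+f_{NU}$, where $f_{sc}$ and $f_{ac}$ are the components of $f$ in the subspaces represented by the singular-continuous and the absolutely continuous spectrum, and $f_{NU}$ is the component of $f$ in the completely non unitary subspace. Assume the indexing is such that $|a_1|\ge|a_2|\ge\dots\ge 0$. Let $d_{NM,1}\ge d_{NM,2}\ge\dots\ge 0$ be the eigenvalues of the Gram matrix $G_{NM}(f)$. Then for every $i$, $$\lim_{N\to\infty}\lim_{M\to\infty}\frac{d_{NM,i}}{N}=|a_i|^2 .$$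
   Context: Autocovariance: $\rho_l=\lim_{n\to\infty}\frac1n\sum_{k=0}^{n}f(k)\overline{f(k+l)}$ for $l\in\mathbb{N}=\{0,1,2,\dots\}$. Hilbert space $\mathcal{H}_f$ and operator $\mathcal{K}$: let $F_l=(f(l),f(l+1),\dots)$ and let $\tilde{\mathcal{H}}_f$ be the complex linear span of $\{F_l:l\in\mathbb{N}\}$, with (semi-)inner product $\langle h,g\rangle=\lim_{n\to\infty}\frac1n\sum_{k=0}^{n-1}h_k\overline{g_k}$ (it exists since all $\rho_l$ exist). $\mathcal{H}_f$ is the Hilbert space completion of $\tilde{\mathcal{H}}_f$ (elements at distance zero are identified). $\mathcal{K}$ is the time shift $\mathcal{K}F_l=F_{l+1}$, extended linearly and by continuity to an isometry of $\mathcal{H}_f$. The element $F_0\in\mathcal{H}_f$ is denoted by $f$. Decomposition of $f$: By the Wold decomposition, $\mathcal{H}_f=\mathcal{H}_{f,NU}\oplus\mathcal{H}_{f,U}$ orthogonally, both summands invariant under $\mathcal{K}$, with $\mathcal{K}$ unitary on $\mathcal{H}_{f,U}$ and acting as a direct sum of unilateral shifts on $\mathcal{H}_{f,NU}$ (the completely non unitary part). Write $f=f_{NU}+f_U$ accordingly; $\mathcal{H}_{f,U}$ is the closed span of $\{\mathcal{K}^nf_U:n\ge0\}$. By the spectral theorem there are a finite measure $\nu_f$ on the unit circle $S^1\subset\mathbb{C}$ and an isometric isomorphism $\phi:\mathcal{H}_{f,U}\to L^2(S^1,d\nu_f)$ with $\phi(f_U)=1$ and $\phi\circ\mathcal{K}\circ\phi^{-1}$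 equal to multiplication by $z$. Decompose $\nu_f=\nu_d+\nu_{sc}+\nu_{ac}$ into its discrete, singular-continuous and absolutely continuous parts (with respect to Lebesgue measure); this induces an orthogonal decomposition of $L^2(S^1,d\nu_f)$ and hence $f_U=f_d+f_{sc}+f_{ac}$. All eigenvectors of $\mathcal{K}$ lie in $\mathcal{H}_{f,U}$, all eigenvalues are simple and there are at most countably many, and $f_d=\sum_i a_iv_i$ with $v_i$ the normalized eigenvectors, one per eigenvalue. If there are only finitely many eigenvectors, the remaining $a_i$ are taken to be $0$. Gram matrix: $G_{NM}(f)$ is the $(N+1)\times(N+1)$ matrix with entries $G_{NM,ij}(f)=\frac1M\sum_{t=0}^{M}f(i+t)\overline{f(j+t)}$, $0\le i,j\le N$. Eigenvalues are listed with multiplicity. *)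

theory Defs
  imports
    "HOL-Analysis.Analysis"
    "HOL-Library.Extended_Nat"
    "Jordan_Normal_Form.Char_Poly"
begin

section \<open>Complex inner product spaces\<close>

text \<open>
  The class extends the real inner product class, so that norm, topology and completeness
  come from the library: \<open>inner\<close> is the real part of \<open>cinner\<close>, hence
  \<open>norm x ^ 2 = cinner x x\<close>.  The complex inner product is linear in the first argument.
  Complex Hilbert spaces are the types of sort \<open>{complex_inner, complete_space}\<close>.
\<close>

class complex_inner = real_inner +
  fixes scaleC :: "complex \<Rightarrow> 'a \<Rightarrow> 'a" (infixr "*\<^sub>C" 75)
    and cinner :: "'a \<Rightarrow> 'a \<Rightarrow> complex"
  assumes scaleC_add_right: "c *\<^sub>C (x + y) = c *\<^sub>C x + c *\<^sub>C y"
    and scaleC_add_left: "(b + c) *\<^sub>C x = b *\<^sub>C x + c *\<^sub>C x"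
    and scaleC_scaleC: "b *\<^sub>C (c *\<^sub>C x) = (b * c) *\<^sub>C x"
    and scaleR_scaleC: "r *\<^sub>R x = complex_of_real r *\<^sub>C x"
    and cinner_commute: "cinner x y = cnj (cinner y x)"
    and cinner_add_left: "cinner (x + y) w = cinner x w + cinner y w"
    and cinner_scaleC_left: "cinner (c *\<^sub>C x) y = c * cinner x y"
    and inner_eq_Re_cinner: "inner x y = Re (cinner x y)"

global_interpretation complex_vector:
  vector_space "scaleC :: complex \<Rightarrow> 'a \<Rightarrow> 'a::complex_inner"
  defines csubspace = complex_vector.subspace
    and cspan = complex_vector.span
proof
  show "1 *\<^sub>C x = x" for x :: 'a
    using scaleR_scaleC[of 1 x] by simp
qed (simp_all add: scaleC_add_right scaleC_add_left scaleC_scaleC)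

definition closed_csubspace :: "'h::complex_inner set \<Rightarrow> bool" where
  "closed_csubspace S \<longleftrightarrow> csubspace S \<and> closed S"

definition corthogonal :: "'h::complex_inner set \<Rightarrow> 'h set \<Rightarrow> bool" where
  "corthogonal S T \<longleftrightarrow> (\<forall>x\<in>S. \<forall>y\<in>T. cinner x y = 0)"


section \<open>The Hilbert space of a time series and the time shift\<close>

definition autocovariance_exists :: "(nat \<Rightarrow> complex) \<Rightarrow> nat \<Rightarrow> bool" where
  "autocovariance_exists f l \<longleftrightarrow>
     convergent (\<lambda>n. (\<Sum>k\<le>n. f k * cnj (f (k + l))) / of_nat n)"

definition shifted :: "(nat \<Rightarrow> complex) \<Rightarrow> nat \<Rightarrow> (nat \<Rightarrow> complex)" where
  "shifted f l = (\<lambda>k. f (l + k))"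

definition shift_span :: "(nat \<Rightarrow> complex) \<Rightarrow> (nat \<Rightarrow> complex) set" where
  "shift_span f = {h. \<exists>n c. h = (\<lambda>k. \<Sum>l\<le>n. c l * shifted f l k)}"

text \<open>
  A completion of the semi-inner product space \<open>shift_span f\<close>: a complex linear map \<open>\<iota>\<close> into
  a complex Hilbert space that preserves the (semi-)inner product.  The completion itself is
  the closure of its range; elements at distance zero are identified by \<open>\<iota>\<close>.
  The ambient space is allowed to be larger than the completion.
\<close>

definition completion_map ::
    "(nat \<Rightarrow> complex) \<Rightarrow> ((nat \<Rightarrow> complex) \<Rightarrow> 'h::{complex_inner, complete_space}) \<Rightarrow> bool" where
  "completion_map f \<iota> \<longleftrightarrow>
     (\<forall>h\<in>shift_span f. \<forall>g\<in>shift_span f. \<iota> (\<lambda>k. h k + g k) = \<iota> h + \<iota> g) \<and>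
     (\<forall>c. \<forall>h\<in>shift_span f. \<iota> (\<lambda>k. c * h k) = c *\<^sub>C \<iota> h) \<and>
     (\<forall>h\<in>shift_span f. \<forall>g\<in>shift_span f.
        (\<lambda>n. (\<Sum>k<n. h k * cnj (g k)) / of_nat n) \<longlonglongrightarrow> cinner (\<iota> h) (\<iota> g))"

definition series_space ::
    "(nat \<Rightarrow> complex) \<Rightarrow> ((nat \<Rightarrow> complex) \<Rightarrow> 'h::{complex_inner, complete_space}) \<Rightarrow> 'h set" where
  "series_space f \<iota> = closure (\<iota> ` shift_span f)"

text \<open>
  Linearity, continuity and the values on the shifted series determine the time shift
  uniquely on \<open>series_space f \<iota>\<close>; its values elsewhere are irrelevant.
\<close>

definition time_shift ::
    "(nat \<Rightarrow> complex) \<Rightarrow> ((nat \<Rightarrow> complex) \<Rightarrow> 'h::{complex_inner, complete_space})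
     \<Rightarrow> ('h \<Rightarrow> 'h) \<Rightarrow> bool" where
  "time_shift f \<iota> K \<longleftrightarrow>
     (\<forall>x\<in>series_space f \<iota>. \<forall>y\<in>series_space f \<iota>. K (x + y) = K x + K y) \<and>
     (\<forall>c. \<forall>x\<in>series_space f \<iota>. K (c *\<^sub>C x) = c *\<^sub>C K x) \<and>
     continuous_on (series_space f \<iota>) K \<and>
     (\<forall>l. K (\<iota> (shifted f l)) = \<iota> (shifted f (Suc l)))"


section \<open>Wold decomposition\<close>

definition unitary_on :: "'h::complex_inner set \<Rightarrow> ('h \<Rightarrow> 'h) \<Rightarrow> bool" where
  "unitary_on S K \<longleftrightarrow> K ` S = S \<and> (\<forall>x\<in>S. \<forall>y\<in>S. cinner (K x) (K y) = cinner x y)"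

text \<open>
  \<open>K\<close> is a direct sum of unilateral shifts on \<open>S\<close>, one for each element of \<open>B\<close>: the vectors
  \<open>(K ^^ m) b\<close> form an orthonormal basis of \<open>S\<close>.
\<close>

definition sum_of_unilateral_shifts_on :: "'h::complex_inner set \<Rightarrow> ('h \<Rightarrow> 'h) \<Rightarrow> bool" where
  "sum_of_unilateral_shifts_on S K \<longleftrightarrow>
     (\<exists>B. (\<forall>b\<in>B. \<forall>c\<in>B. \<forall>m n.
             cinner ((K ^^ m) b) ((K ^^ n) c) = (if b = c \<and> m = n then 1 else 0)) \<and>
          S = closure (cspan {(K ^^ m) b | m b. b \<in> B}))"

definition wold_decomposition ::
    "'h::complex_inner set \<Rightarrow> ('h \<Rightarrow> 'h) \<Rightarrow> 'h set \<Rightarrow> 'h set \<Rightarrow> bool" where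
  "wold_decomposition H K H_NU H_U \<longleftrightarrow>
     closed_csubspace H_NU \<and> closed_csubspace H_U \<and>
     corthogonal H_NU H_U \<and> H = {x + y | x y. x \<in> H_NU \<and> y \<in> H_U} \<and>
     K ` H_NU \<subseteq> H_NU \<and> K ` H_U \<subseteq> H_U \<and>
     sum_of_unilateral_shifts_on H_NU K \<and> unitary_on H_U K"


section \<open>Spectral representation of the unitary part\<close>

definition circle_borel :: "complex measure" where
  "circle_borel = restrict_space borel (sphere 0 1)"

definition circle_lebesgue :: "complex measure" where
  "circle_lebesgue = distr (restrict_space lborel {0..<2 * pi}) circle_borel cis"

text \<open>Square integrable functions; elements of \<open>L\<^sup>2\<close> are represented by functions, up to
  equality almost everywhere.\<close>

definition L2_functions :: "complex measure \<Rightarrow> (complex \<Rightarrow> complex) set" where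
  "L2_functions \<nu> =
     {g. g \<in> borel_measurable \<nu> \<and> integrable \<nu> (\<lambda>z. (cmod (g z))\<^sup>2)}"

definition L2_isomorphism ::
    "'h::complex_inner set \<Rightarrow> complex measure \<Rightarrow> ('h \<Rightarrow> complex \<Rightarrow> complex) \<Rightarrow> bool" where
  "L2_isomorphism H \<nu> \<phi> \<longleftrightarrow>
     (\<forall>x\<in>H. \<phi> x \<in> L2_functions \<nu>) \<and>
     (\<forall>x\<in>H. \<forall>y\<in>H. AE z in \<nu>. \<phi> (x + y) z = \<phi> x z + \<phi> y z) \<and>
     (\<forall>c. \<forall>x\<in>H. AE z in \<nu>. \<phi> (c *\<^sub>C x) z = c * \<phi> x z) \<and>
     (\<forall>x\<in>H. \<forall>y\<in>H. (\<integral>z. \<phi> x z * cnj (\<phi> y z) \<partial>\<nu>) = cinner x y) \<and>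
     (\<forall>g\<in>L2_functions \<nu>. \<exists>x\<in>H. AE z in \<nu>. \<phi> x z = g z)"

definition spectral_representation ::
    "'h::complex_inner set \<Rightarrow> ('h \<Rightarrow> 'h) \<Rightarrow> 'h \<Rightarrow> complex measure
     \<Rightarrow> ('h \<Rightarrow> complex \<Rightarrow> complex) \<Rightarrow> bool" where
  "spectral_representation H_U K f_U \<nu> \<phi> \<longleftrightarrow>
     finite_measure \<nu> \<and> sets \<nu> = sets circle_borel \<and>
     L2_isomorphism H_U \<nu> \<phi> \<and>
     (AE z in \<nu>. \<phi> f_U z = 1) \<and>
     (\<forall>x\<in>H_U. AE z in \<nu>. \<phi> (K x) z = z * \<phi> x z)"

definition discrete_measure :: "complex measure \<Rightarrow> bool" where
  "discrete_measure \<mu> \<longleftrightarrow> (\<exists>C. countable C \<and> (AE z in \<mu>. z \<in> C))"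

definition singular_continuous_measure :: "complex measure \<Rightarrow> bool" where
  "singular_continuous_measure \<mu> \<longleftrightarrow>
     (\<forall>z. emeasure \<mu> {z} = 0) \<and> (\<exists>E\<in>null_sets circle_lebesgue. AE z in \<mu>. z \<in> E)"

definition lebesgue_decomposition ::
    "complex measure \<Rightarrow> complex measure \<Rightarrow> complex measure \<Rightarrow> complex measure \<Rightarrow> bool" where
  "lebesgue_decomposition \<nu> \<nu>_d \<nu>_sc \<nu>_ac \<longleftrightarrow>
     sets \<nu>_d = sets \<nu> \<and> sets \<nu>_sc = sets \<nu> \<and> sets \<nu>_ac = sets \<nu> \<and>
     (\<forall>A\<in>sets \<nu>. emeasure \<nu> A = emeasure \<nu>_d A + emeasure \<nu>_sc A + emeasure \<nu>_ac A) \<and>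
     discrete_measure \<nu>_d \<and> singular_continuous_measure \<nu>_sc \<and>
     absolutely_continuous circle_lebesgue \<nu>_ac"

text \<open>
  When \<open>\<nu>\<close> is the sum of three mutually singular measures, the summand of \<open>L\<^sup>2 \<nu>\<close> belonging to one
  of them consists of the functions that vanish almost everywhere for the other two, \<open>\<mu>\<close> and \<open>\<mu>'\<close>.
\<close>

definition spectral_component ::
    "'h::complex_inner set \<Rightarrow> ('h \<Rightarrow> complex \<Rightarrow> complex) \<Rightarrow> complex measure \<Rightarrow> complex measure
     \<Rightarrow> 'h set" where
  "spectral_component H_U \<phi> \<mu> \<mu>' =
     {x \<in> H_U. (AE z in \<mu>. \<phi> x z = 0) \<and> (AE z in \<mu>'. \<phi> x z = 0)}"

definition spectral_splitting ::
    "'h::complex_inner set \<Rightarrow> ('h \<Rightarrow> 'h) \<Rightarrow> 'h \<Rightarrow> 'h \<Rightarrow> 'h \<Rightarrow> 'h \<Rightarrow> bool" where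
  "spectral_splitting H_U K f_U f_d f_sc f_ac \<longleftrightarrow>
     (\<exists>\<nu> \<nu>_d \<nu>_sc \<nu>_ac \<phi>.
        spectral_representation H_U K f_U \<nu> \<phi> \<and>
        lebesgue_decomposition \<nu> \<nu>_d \<nu>_sc \<nu>_ac \<and>
        f_U = f_d + f_sc + f_ac \<and>
        f_d \<in> spectral_component H_U \<phi> \<nu>_sc \<nu>_ac \<and>
        f_sc \<in> spectral_component H_U \<phi> \<nu>_d \<nu>_ac \<and>
        f_ac \<in> spectral_component H_U \<phi> \<nu>_d \<nu>_sc)"


section \<open>Eigenvectors of the time shift\<close>

definition point_spectrum :: "'h::complex_inner set \<Rightarrow> ('h \<Rightarrow> 'h) \<Rightarrow> complex set" where
  "point_spectrum H K = {z. \<exists>x\<in>H. x \<noteq> 0 \<and> K x = z *\<^sub>C x}"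

text \<open>
  The vectors \<open>v i\<close> with \<open>i < n\<close> are unit eigenvectors of \<open>K\<close>, exactly one for each eigenvalue;
  \<open>n\<close> is the number of eigenvalues, possibly infinite.
\<close>

definition eigenvector_enumeration ::
    "'h::complex_inner set \<Rightarrow> ('h \<Rightarrow> 'h) \<Rightarrow> enat \<Rightarrow> (nat \<Rightarrow> 'h) \<Rightarrow> bool" where
  "eigenvector_enumeration H K n v \<longleftrightarrow>
     (\<exists>ev. bij_betw ev {i. enat i < n} (point_spectrum H K) \<and>
           (\<forall>i. enat i < n \<longrightarrow> v i \<in> H \<and> norm (v i) = 1 \<and> K (v i) = ev i *\<^sub>C v i))"


section \<open>Gram matrices\<close>

definition gram_matrix :: "(nat \<Rightarrow> complex) \<Rightarrow> nat \<Rightarrow> nat \<Rightarrow> complex mat" where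
  "gram_matrix f N M =
     mat (N + 1) (N + 1) (\<lambda>(i, j). (\<Sum>t\<le>M. f (i + t) * cnj (f (j + t))) / of_nat M)"

text \<open>
  The eigenvalues of an \<open>m \<times> m\<close> matrix, with (algebraic) multiplicity, are the nonnegative reals
  \<open>d 0 \<ge> \<dots> \<ge> d (m - 1)\<close>.
\<close>

definition eigenvalues_decreasing :: "complex mat \<Rightarrow> (nat \<Rightarrow> real) \<Rightarrow> bool" where
  "eigenvalues_decreasing A d \<longleftrightarrow>
     antimono_on {..<dim_row A} d \<and> (\<forall>i<dim_row A. 0 \<le> d i) \<and>
     char_poly A = (\<Prod>i<dim_row A. [:- complex_of_real (d i), 1:])"

end

theory Submission
  imports Defs "Jordan_Normal_Form.Schur_Decomposition" "HOL-Library.Function_Algebras"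
begin

text \<open>
  Let \<open>g k\<close> be the vector of the series shifted by \<open>k\<close>.  As \<open>M\<close> tends to infinity the Gram matrix
  converges entrywise to the matrix of the inner products \<open>\<langle>g i, g j\<rangle>\<close>, and by Weyl's inequality
  (\<open>eigenvalue_perturbation\<close>) so do its ordered eigenvalues.  The limit matrix has the same nonzero
  eigenvalues as the operator \<open>\<Sum>\<^sub>k g\<^sub>k \<otimes> g\<^sub>k\<^sup>*\<close> (\<open>gram_eigenbasis_frame\<close>).  Let \<open>S\<^sub>N\<close> be this operator divided by
  \<open>N + 1\<close>, and let \<open>S = \<Sum>\<^sub>m |a m|\<^sup>2 v\<^sub>m \<otimes> v\<^sub>m\<^sup>*\<close>, whose nonzero eigenvalues are the nonzero numbers \<open>|a m|\<^sup>2\<close>.  The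
  claim follows from the min-max principle (\<open>frame_comparison\<close>) once \<open>S\<^sub>N\<close> tends to \<open>S\<close> in the
  Hilbert-Schmidt norm.

  The squared norm of the difference is \<open>tr S\<^sub>N\<^sup>2 - 2 tr S\<^sub>N S + tr S\<^sup>2\<close>.  Here \<open>tr S\<^sup>2 = \<Sum>\<^sub>m |a m|\<^sup>4\<close>.  The same
  value is taken by \<open>tr S\<^sub>N S\<close> for every \<open>N\<close>, since \<open>|\<langle>g k, v m\<rangle>| = |a m|\<close> for all \<open>k\<close>: the time shift only
  multiplies the correlation with an eigenvector by a number of modulus one.  The remaining term \<open>tr S\<^sub>N\<^sup>2\<close>
  is the mean of the numbers \<open>|\<langle>g j, g k\<rangle>|\<^sup>2\<close>.  The inner product \<open>\<langle>g j, g k\<rangle>\<close> is the sum of the Fourier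
  coefficient of \<open>\<nu>\<close> at \<open>j - k\<close> and the correlation of the completely non unitary part.  The latter
  tends to zero with growing time lag (\<open>unilateral_shifts_weakly_null\<close>), hence vanishes in the mean.  For
  the former Wiener's theorem (\<open>wiener_mean_square\<close>) gives the sum of the squares of the atoms of \<open>\<nu>\<close>.
  In the spectral representation the eigenvectors are the functions concentrated at one atom, and
  the atom belonging to \<open>v m\<close> has mass \<open>|a m|\<^sup>2\<close> (\<open>cinner_power_unit_eigenvector\<close>).  Thus
  \<open>tr S\<^sub>N\<^sup>2\<close> tends to \<open>\<Sum>\<^sub>m |a m|\<^sup>4\<close> and the norm of the difference tends to zero.

  In the formal argument \<open>S\<close> is truncated to finitely many eigenvectors, and operators appear only
  through their quadratic forms and through the double sums that express their traces.
\<close>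

section \<open>The min-max comparison of quadratic forms\<close>

text \<open>
  The dimension count of the min-max argument: \<open>i\<close> linear conditions cannot reduce a space of
  dimension \<open>i + 1\<close> to zero.
\<close>

lemma underdetermined_system:
  fixes c :: "nat \<Rightarrow> nat \<Rightarrow> complex"
  shows "\<exists>x. (\<exists>k\<le>i. x k \<noteq> 0) \<and> (\<forall>j<i. (\<Sum>k\<le>i. x k * c j k) = 0)"
proof -
  define A where "A = mat (Suc i) (Suc i) (\<lambda>(j, k). if j < i then c j k else 0)"
  have A: "A \<in> carrier_mat (Suc i) (Suc i)" by (simp add: A_def)
  have "det A = (\<Sum>j<Suc i. A $$ (i, j) * cofactor A i j)"
    by (rule laplace_expansion_row[OF A]) simp
  then have "det A = 0"
    by (simp add: A_def)
  then obtain v where v: "v \<in> carrier_vec (Suc i)" "v \<noteq> 0\<^sub>v (Suc i)" "A *\<^sub>v v = 0\<^sub>v (Suc i)"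
    using det_0_iff_vec_prod_zero_field[OF A] by blast
  have "\<exists>k\<le>i. v $ k \<noteq> 0"
  proof (rule ccontr)
    assume "\<not> ?thesis"
    then have "v = 0\<^sub>v (Suc i)"
      using v(1) by (intro eq_vecI) auto
    with v(2) show False by simp
  qed
  moreover have "(\<Sum>k\<le>i. v $ k * c j k) = 0" if "j < i" for j
  proof -
    have "0 = (A *\<^sub>v v) $ j" using v(3) that by simp
    also have "\<dots> = (\<Sum>k<Suc i. A $$ (j, k) * v $ k)"
      using A v(1) that by (simp add: scalar_prod_def lessThan_atLeast0)
    also have "\<dots> = (\<Sum>k\<le>i. v $ k * c j k)"
      unfolding lessThan_Suc_atMost using that
      by (intro sum.cong) (auto simp: A_def)
    finally show ?thesis by simp
  qed
  ultimately show ?thesis by blast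
qed

text \<open>
  The min-max argument is applied both to the Hilbert space and to coordinate vectors of varying
  length.  Coordinate vectors of length \<open>n\<close> are represented by functions on all natural numbers, so
  that their inner product is only semidefinite.
\<close>

locale semi_inner_product =
  fixes scale :: "complex \<Rightarrow> 'a::ab_group_add \<Rightarrow> 'a"
    and ip :: "'a \<Rightarrow> 'a \<Rightarrow> complex"
  assumes ip_add_left: "ip (x + y) z = ip x z + ip y z"
    and ip_scale_left: "ip (scale c x) y = c * ip x y"
    and ip_commute: "ip x y = cnj (ip y x)"
    and ip_self_nonneg: "0 \<le> Re (ip x x)"
begin

definition sqnorm :: "'a \<Rightarrow> real" where "sqnorm x = Re (ip x x)"

lemma sqnorm_nonneg: "0 \<le> sqnorm x"
  by (simp add: sqnorm_def ip_self_nonneg)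

lemma ip_self: "ip x x = of_real (sqnorm x)"
  by (metis Reals_cnj_iff complex_is_Real_iff ip_commute of_real_Re sqnorm_def)

lemma ip_zero_left [simp]: "ip 0 y = 0"
  using ip_add_left[of 0 0 y] by simp

lemma ip_zero_right [simp]: "ip y 0 = 0"
  by (subst ip_commute) simp

lemma ip_add_right: "ip z (x + y) = ip z x + ip z y"
  by (metis complex_cnj_add ip_add_left ip_commute)

lemma ip_scale_right: "ip y (scale c x) = cnj c * ip y x"
  by (metis complex_cnj_mult ip_commute ip_scale_left)

lemma ip_diff_left: "ip (x - y) z = ip x z - ip y z"
  using ip_add_left[of "x - y" y z] by simp

lemma ip_diff_right: "ip z (x - y) = ip z x - ip z y"
  using ip_add_right[of z "x - y" y] by simp

lemma ip_sum_left: "ip (\<Sum>i\<in>I. g i) y = (\<Sum>i\<in>I. ip (g i) y)"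
  by (induction I rule: infinite_finite_induct) (simp_all add: ip_add_left)

lemma ip_sum_right: "ip y (\<Sum>i\<in>I. g i) = (\<Sum>i\<in>I. ip y (g i))"
  by (induction I rule: infinite_finite_induct) (simp_all add: ip_add_right)

lemma ip_mult_cnj: "ip x y * ip y x = of_real ((cmod (ip x y))\<^sup>2)"
  using ip_commute[of y x] by (simp only: complex_norm_square)

lemma ip_orthogonal_sum_left:
  assumes "finite I" "k \<in> I" "\<And>m l. m \<in> I \<Longrightarrow> l \<in> I \<Longrightarrow> m \<noteq> l \<Longrightarrow> ip (w m) (w l) = 0"
  shows "ip (\<Sum>m\<in>I. scale (c m) (w m)) (w k) = c k * of_real (sqnorm (w k))"
proof -
  have "ip (\<Sum>m\<in>I. scale (c m) (w m)) (w k) = (\<Sum>m\<in>I. if m = k then c k * ip (w k) (w k) else 0)"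
    unfolding ip_sum_left ip_scale_left using assms by (intro sum.cong) auto
  then show ?thesis using assms by (simp add: ip_self)
qed

lemma sqnorm_orthogonal_sum:
  assumes "finite I" "\<And>m l. m \<in> I \<Longrightarrow> l \<in> I \<Longrightarrow> m \<noteq> l \<Longrightarrow> ip (w m) (w l) = 0"
  shows "sqnorm (\<Sum>m\<in>I. scale (c m) (w m)) = (\<Sum>m\<in>I. (cmod (c m))\<^sup>2 * sqnorm (w m))"
proof -
  let ?z = "\<Sum>m\<in>I. scale (c m) (w m)"
  have "ip ?z ?z = (\<Sum>k\<in>I. cnj (c k) * ip ?z (w k))"
    by (subst ip_sum_right) (simp add: ip_scale_right)
  also have "\<dots> = (\<Sum>k\<in>I. of_real ((cmod (c k))\<^sup>2 * sqnorm (w k)))"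
  proof (rule sum.cong)
    fix k assume k: "k \<in> I"
    have "cnj (c k) * ip ?z (w k) = c k * cnj (c k) * of_real (sqnorm (w k))"
      by (subst ip_orthogonal_sum_left[OF assms(1) k]) (use assms(2) in auto)
    then show "cnj (c k) * ip ?z (w k) = of_real ((cmod (c k))\<^sup>2 * sqnorm (w k))"
      by (simp only: complex_norm_square of_real_mult)
  qed simp
  finally show ?thesis by (simp add: sqnorm_def del: of_real_mult of_real_power)
qed

text \<open>
  The square norm of \<open>h - c\<^sup>-\<^sup>1 \<Sum>\<^sub>m \<langle>h, w m\<rangle> w m\<close> is nonnegative; expanding it gives Bessel's
  inequality for orthogonal vectors of varying length.
\<close>

lemma bessel_weighted:
  assumes fin: "finite I"
    and orth: "\<And>m l. m \<in> I \<Longrightarrow> l \<in> I \<Longrightarrow> m \<noteq> l \<Longrightarrow> ip (w m) (w l) = 0"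
    and c: "\<And>m. m \<in> I \<Longrightarrow> sqnorm (w m) \<le> c" "0 < c"
  shows "(\<Sum>m\<in>I. (cmod (ip h (w m)))\<^sup>2) \<le> c * sqnorm h"
proof -
  let ?z = "\<Sum>m\<in>I. scale (ip h (w m)) (w m)"
  define S where "S = (\<Sum>m\<in>I. (cmod (ip h (w m)))\<^sup>2)"
  have hz: "ip h ?z = of_real S"
    unfolding ip_sum_right ip_scale_right S_def of_real_sum
    by (intro sum.cong refl) (simp only: complex_norm_square mult.commute)
  have "ip ?z h = of_real S"
    using hz ip_commute[of ?z h] by simp
  then have "sqnorm (h - scale (of_real (1 / c)) ?z) = sqnorm h - 2 * S / c + sqnorm ?z / c\<^sup>2"
    using hz
    by (simp add: sqnorm_def ip_diff_left ip_diff_right ip_scale_left ip_scale_right power2_eq_square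
        diff_divide_distrib del: of_real_divide)
  moreover have "sqnorm ?z \<le> c * S"
    by (subst sqnorm_orthogonal_sum[OF fin orth])
      (auto simp: S_def sum_distrib_left intro!: sum_mono mult_right_mono c(1) simp: mult.commute[of _ "sqnorm _"])
  then have "sqnorm ?z / c\<^sup>2 \<le> c * S / c\<^sup>2"
    by (rule divide_right_mono) simp
  moreover have "0 \<le> sqnorm (h - scale (of_real (1 / c)) ?z)"
    by (rule sqnorm_nonneg)
  ultimately have "0 \<le> sqnorm h - 2 * S / c + c * S / c\<^sup>2"
    by linarith
  also have "\<dots> = sqnorm h - S / c"
    using c(2) by (simp add: power2_eq_square field_simps)
  finally show ?thesis
    using c(2) by (simp add: S_def field_simps)
qed

text \<open>
  The Courant-Fischer principle, stated for quadratic forms \<open>x \<mapsto> \<Sum>\<^sub>k |\<langle>x, h k\<rangle>|\<^sup>2\<close> of orthogonal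
  families: the nonzero eigenvalues of such a form are the nonzero squared norms of the vectors.  Some nonzero \<open>x\<close> in
  the span of the first \<open>i + 1\<close> vectors \<open>h k\<close> is orthogonal to the first \<open>i\<close> vectors \<open>w k\<close>.  For this
  \<open>x\<close> the form of \<open>h\<close> is at least \<open>\<parallel>h i\<parallel>\<^sup>2 \<parallel>x\<parallel>\<^sup>2\<close> and the form of \<open>w\<close> is at most \<open>\<parallel>w i\<parallel>\<^sup>2 \<parallel>x\<parallel>\<^sup>2\<close>.
\<close>

lemma frame_comparison:
  fixes h w :: "nat \<Rightarrow> 'a"
  assumes orth_h: "\<And>k l. k \<le> N \<Longrightarrow> l \<le> N \<Longrightarrow> k \<noteq> l \<Longrightarrow> ip (h k) (h l) = 0"
    and orth_w: "\<And>k l. k < p \<Longrightarrow> l < p \<Longrightarrow> k \<noteq> l \<Longrightarrow> ip (w k) (w l) = 0"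
    and dec_h: "\<And>k l. k \<le> l \<Longrightarrow> l \<le> N \<Longrightarrow> sqnorm (h l) \<le> sqnorm (h k)"
    and dec_w: "\<And>k l. k \<le> l \<Longrightarrow> l < p \<Longrightarrow> sqnorm (w l) \<le> sqnorm (w k)"
    and i: "i \<le> N" "i < p" and \<eta>: "0 \<le> \<eta>"
    and le: "\<And>x. (\<Sum>k\<le>N. (cmod (ip x (h k)))\<^sup>2) \<le> (\<Sum>k<p. (cmod (ip x (w k)))\<^sup>2) + \<eta> * sqnorm x"
  shows "sqnorm (h i) \<le> sqnorm (w i) + \<eta>"
proof (cases "sqnorm (h i) = 0")
  case True
  then show ?thesis using \<eta> sqnorm_nonneg[of "w i"] by simp
next
  case False
  then have hi: "0 < sqnorm (h i)" using sqnorm_nonneg[of "h i"] by simp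
  \<comment> \<open>a nonzero vector in the span of \<open>h 0, \<dots>, h i\<close> that is orthogonal to \<open>w 0, \<dots>, w (i - 1)\<close>\<close>
  obtain \<alpha> where \<alpha>: "\<exists>k\<le>i. \<alpha> k \<noteq> 0" "\<forall>j<i. (\<Sum>k\<le>i. \<alpha> k * ip (h k) (w j)) = 0"
    using underdetermined_system[of i "\<lambda>j k. ip (h k) (w j)"] by blast
  define x where "x = (\<Sum>k\<in>{..i}. scale (\<alpha> k) (h k))"
  have orth: "\<And>k l. k \<in> {..i} \<Longrightarrow> l \<in> {..i} \<Longrightarrow> k \<noteq> l \<Longrightarrow> ip (h k) (h l) = 0"
    using orth_h i by auto
  have xn: "sqnorm x = (\<Sum>k\<le>i. (cmod (\<alpha> k))\<^sup>2 * sqnorm (h k))"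
    unfolding x_def by (rule sqnorm_orthogonal_sum) (use orth in auto)
  obtain k where k: "k \<le> i" "\<alpha> k \<noteq> 0" using \<alpha>(1) by blast
  have "0 < (cmod (\<alpha> k))\<^sup>2 * sqnorm (h k)"
    using k hi dec_h[OF k(1) i(1)] by simp
  then have xpos: "0 < sqnorm x"
    unfolding xn using k(1) by (intro sum_pos2[of _ k]) (auto simp: sqnorm_nonneg)
  have "sqnorm (h i) * sqnorm x = (\<Sum>k\<le>i. (cmod (\<alpha> k))\<^sup>2 * sqnorm (h k) * sqnorm (h i))"
    unfolding xn sum_distrib_left by (simp add: mult_ac)
  also have "\<dots> \<le> (\<Sum>k\<le>i. (cmod (\<alpha> k))\<^sup>2 * sqnorm (h k) * sqnorm (h k))"
    using dec_h i by (intro sum_mono mult_left_mono) (auto simp: sqnorm_nonneg)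
  also have "\<dots> = (\<Sum>k\<le>i. (cmod (ip x (h k)))\<^sup>2)"
  proof (rule sum.cong)
    fix k assume k: "k \<in> {..i}"
    have "ip x (h k) = \<alpha> k * of_real (sqnorm (h k))"
      unfolding x_def by (rule ip_orthogonal_sum_left) (use k orth in auto)
    then show "(cmod (\<alpha> k))\<^sup>2 * sqnorm (h k) * sqnorm (h k) = (cmod (ip x (h k)))\<^sup>2"
      by (simp add: norm_mult power_mult_distrib power2_eq_square)
  qed simp
  also have "\<dots> \<le> (\<Sum>k\<le>N. (cmod (ip x (h k)))\<^sup>2)"
    using i by (intro sum_mono2) auto
  also have "\<dots> \<le> (\<Sum>k<p. (cmod (ip x (w k)))\<^sup>2) + \<eta> * sqnorm x"
    by (rule le)
  also have "(\<Sum>k<p. (cmod (ip x (w k)))\<^sup>2) = (\<Sum>k\<in>{i..<p}. (cmod (ip x (w k)))\<^sup>2)"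
  proof (rule sum.mono_neutral_right)
    show "\<forall>k\<in>{..<p} - {i..<p}. (cmod (ip x (w k)))\<^sup>2 = 0"
      using \<alpha>(2) by (auto simp: x_def ip_sum_left ip_scale_left)
  qed auto
  finally have *: "sqnorm (h i) * sqnorm x
      \<le> (\<Sum>k\<in>{i..<p}. (cmod (ip x (w k)))\<^sup>2) + \<eta> * sqnorm x" by simp
  show ?thesis
    \<comment> \<open>the slack makes the bound on the squared norms strictly positive, even if \<open>w i\<close> is null\<close>
  proof (rule field_le_epsilon)
    fix \<delta> :: real assume \<delta>: "0 < \<delta>"
    have "(\<Sum>k\<in>{i..<p}. (cmod (ip x (w k)))\<^sup>2) \<le> (sqnorm (w i) + \<delta>) * sqnorm x"
    proof (rule bessel_weighted)
      fix m assume "m \<in> {i..<p}"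
      then have "sqnorm (w m) \<le> sqnorm (w i)" using dec_w by auto
      then show "sqnorm (w m) \<le> sqnorm (w i) + \<delta>" using \<delta> by simp
    qed (use orth_w \<delta> sqnorm_nonneg[of "w i"] in auto)
    with * have "sqnorm (h i) * sqnorm x \<le> (sqnorm (w i) + \<eta> + \<delta>) * sqnorm x"
      by (simp add: algebra_simps)
    then show "sqnorm (h i) \<le> sqnorm (w i) + \<eta> + \<delta>"
      using xpos by simp
  qed
qed

end

section \<open>Unitary diagonalization of Hermitian matrices\<close>

definition coord_inner :: "nat \<Rightarrow> (nat \<Rightarrow> complex) \<Rightarrow> (nat \<Rightarrow> complex) \<Rightarrow> complex" where
  "coord_inner n x y = (\<Sum>k<n. x k * cnj (y k))"

interpretation coord: semi_inner_product "\<lambda>c x k. c * x k" "coord_inner n" for n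
proof
  fix x :: "nat \<Rightarrow> complex"
  show "0 \<le> Re (coord_inner n x x)"
    by (simp add: coord_inner_def complex_mult_cnj sum_nonneg)
qed (simp_all add: coord_inner_def sum.distrib algebra_simps sum_distrib_left)

lemma coord_sqnorm: "coord.sqnorm n x = (\<Sum>k<n. (cmod (x k))\<^sup>2)"
  by (simp add: coord.sqnorm_def coord_inner_def complex_mult_cnj cmod_power2)

lemma coord_sqnorm_pos:
  assumes "k < n" "x k \<noteq> 0"
  shows "0 < coord.sqnorm n x"
  unfolding coord_sqnorm using assms by (intro sum_pos2[of _ k]) auto

lemma coord_inner_cong:
  assumes "\<And>k. k < n \<Longrightarrow> x k = x' k" "\<And>k. k < n \<Longrightarrow> y k = y' k"
  shows "coord_inner n x y = coord_inner n x' y'"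
  unfolding coord_inner_def using assms by (intro sum.cong) auto

lemma coord_inner_combination:
  fixes s :: nat
  assumes orth: "\<And>i j. i < s \<Longrightarrow> j < s \<Longrightarrow> coord_inner n (u i) (u j) = (if i = j then 1 else 0)"
    and j: "j < s"
  shows "coord_inner n (\<lambda>k. \<Sum>i<s. c i * u i k) (u j) = c j"
proof -
  have "coord_inner n (\<lambda>k. \<Sum>i<s. c i * u i k) (u j) = (\<Sum>i<s. c i * coord_inner n (u i) (u j))"
    by (simp add: coord_inner_def sum_distrib_left sum_distrib_right mult.assoc) (rule sum.swap)
  also have "\<dots> = (\<Sum>i<s. if i = j then c j else 0)"
    using orth j by (intro sum.cong) auto
  finally show ?thesis using j by simp
qed

text \<open>
  Gram-Schmidt turns a basis \<open>p\<close> on which \<open>A\<close> acts by an upper triangular matrix \<open>B\<close> into a basis of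
  eigenvectors when \<open>A\<close> is Hermitian: the image of a new vector has no component along the earlier
  eigenvectors, because those span an invariant space orthogonal to the new vector.  The dual basis
  \<open>q\<close> shows that the orthogonalized vectors do not vanish: before it is
  normalized, the \<open>s\<close>-th one has coordinate one at \<open>p s\<close>.  The last two conjuncts keep the induction going.
\<close>

lemma hermitian_flag_eigenvectors:
  fixes A :: "nat \<Rightarrow> nat \<Rightarrow> complex"
  assumes herm: "\<And>k l. k < n \<Longrightarrow> l < n \<Longrightarrow> A k l = cnj (A l k)"
    and dual: "\<And>m j. m < n \<Longrightarrow> j < n \<Longrightarrow> (\<Sum>k<n. q m k * p j k) = (if m = j then 1 else 0)"
    and flag: "\<And>j k. j < n \<Longrightarrow> k < n \<Longrightarrow> (\<Sum>l<n. A k l * p j l) = (\<Sum>i\<le>j. B i j * p i k)"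
    and s: "s \<le> n"
  shows "\<exists>u. (\<forall>i<s. \<forall>j<s. coord_inner n (u i) (u j) = (if i = j then 1 else 0)) \<and>
             (\<forall>i<s. \<forall>k<n. (\<Sum>l<n. A k l * u i l) = B i i * u i k) \<and>
             (\<forall>j<s. \<forall>m<n. j < m \<longrightarrow> (\<Sum>k<n. q m k * u j k) = 0) \<and>
             (\<exists>c. \<forall>j<s. \<forall>k<n. p j k = (\<Sum>i<s. c j i * u i k))"
  using s
proof (induction s)
  case 0
  show ?case by simp
next
  case (Suc s)
  then have sn: "s < n" by simp
  from Suc.IH[OF less_imp_le[OF sn]] obtain u c where
      IH: "\<forall>i<s. \<forall>j<s. coord_inner n (u i) (u j) = (if i = j then 1 else 0)"
        "\<forall>i<s. \<forall>k<n. (\<Sum>l<n. A k l * u i l) = B i i * u i k"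
        "\<forall>j<s. \<forall>m<n. j < m \<longrightarrow> (\<Sum>k<n. q m k * u j k) = 0"
        "\<forall>j<s. \<forall>k<n. p j k = (\<Sum>i<s. c j i * u i k)"
    by (elim exE conjE) (rule that)
  have orth: "\<And>i j. i < s \<Longrightarrow> j < s \<Longrightarrow> coord_inner n (u i) (u j) = (if i = j then 1 else 0)"
    and eig: "\<And>i k. i < s \<Longrightarrow> k < n \<Longrightarrow> (\<Sum>l<n. A k l * u i l) = B i i * u i k"
    and qu: "\<And>j m. j < s \<Longrightarrow> m < n \<Longrightarrow> j < m \<Longrightarrow> (\<Sum>k<n. q m k * u j k) = 0"
    and pu: "\<And>j k. j < s \<Longrightarrow> k < n \<Longrightarrow> p j k = (\<Sum>i<s. c j i * u i k)"
    subgoal using IH(1) by blast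
    subgoal using IH(2) by blast
    subgoal using IH(3) by blast
    subgoal using IH(4) by blast
    done
  define a where "a j = coord_inner n (p s) (u j)" for j
  define r where "r k = p s k - (\<Sum>j<s. a j * u j k)" for k
  have r_fun: "r = p s - (\<lambda>k. \<Sum>j<s. a j * u j k)"
    by (auto simp: r_def)
  have r_orth: "coord_inner n r (u j) = 0" if "j < s" for j
    unfolding r_fun coord.ip_diff_left using coord_inner_combination[OF orth that, of a]
    by (simp add: a_def)
  have q_comb: "(\<Sum>k<n. q m k * (\<Sum>j<s. b j * u j k)) = 0" if "s \<le> m" "m < n" for m b
  proof -
    have "(\<Sum>k<n. q m k * (\<Sum>j<s. b j * u j k)) = (\<Sum>j<s. b j * (\<Sum>k<n. q m k * u j k))"
      unfolding sum_distrib_left by (subst sum.swap) (simp add: mult_ac)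
    also have "\<dots> = 0" using qu that by (intro sum.neutral) auto
    finally show ?thesis .
  qed
  have qr: "(\<Sum>k<n. q m k * r k) = (if m = s then 1 else 0)" if "s \<le> m" "m < n" for m
    unfolding r_def right_diff_distrib sum_subtractf using q_comb[OF that] dual[OF that(2) sn] by simp
  have "\<exists>k<n. r k \<noteq> 0"
    using qr[of s] sn by (metis (no_types, lifting) le_refl lessThan_iff mult_zero_right sum.neutral zero_neq_one)
  then have pos: "0 < coord.sqnorm n r" using coord_sqnorm_pos by blast
  \<comment> \<open>since \<open>A\<close> is triangular on the \<open>p j\<close>, it maps \<open>r\<close> to a multiple of \<open>r\<close> plus a combination of
    the earlier eigenvectors; symmetry then makes the coefficients of that combination vanish\<close>
  have Apr: "(\<Sum>l<n. A k l * r l) = B s s * r k + (\<Sum>j<s. b j * u j k)"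
    if "k < n" "b = (\<lambda>j. B s s * a j + (\<Sum>i<s. B i s * c i j) - a j * B j j)" for k b
  proof -
    have "(\<Sum>l<n. A k l * (\<Sum>j<s. a j * u j l)) = (\<Sum>j<s. a j * (\<Sum>l<n. A k l * u j l))"
      unfolding sum_distrib_left by (subst sum.swap) (simp add: mult_ac)
    also have "\<dots> = (\<Sum>j<s. a j * B j j * u j k)"
      using eig that(1) by (intro sum.cong) auto
    finally have 1: "(\<Sum>l<n. A k l * (\<Sum>j<s. a j * u j l)) = (\<Sum>j<s. a j * B j j * u j k)" .
    have "(\<Sum>l<n. A k l * p s l) = B s s * p s k + (\<Sum>i<s. B i s * p i k)"
      using flag[OF sn that(1)] by (simp add: lessThan_Suc_atMost[symmetric])
    also have "(\<Sum>i<s. B i s * p i k) = (\<Sum>i<s. \<Sum>j<s. B i s * c i j * u j k)"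
      using pu that(1) by (intro sum.cong) (auto simp: sum_distrib_left mult.assoc)
    also have "\<dots> = (\<Sum>j<s. (\<Sum>i<s. B i s * c i j) * u j k)"
      by (subst sum.swap) (simp add: sum_distrib_right)
    finally have 2: "(\<Sum>l<n. A k l * p s l) = B s s * p s k + (\<Sum>j<s. (\<Sum>i<s. B i s * c i j) * u j k)" .
    have "(\<Sum>l<n. A k l * r l) = (\<Sum>l<n. A k l * p s l) - (\<Sum>l<n. A k l * (\<Sum>j<s. a j * u j l))"
      by (simp add: r_def right_diff_distrib sum_subtractf)
    then show ?thesis
      unfolding 1 2 that(2)
      by (simp add: r_def algebra_simps sum.distrib sum_subtractf sum_distrib_left)
  qed
  define b where "b = (\<lambda>j. B s s * a j + (\<Sum>i<s. B i s * c i j) - a j * B j j)"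
  define Ar where "Ar k = (\<Sum>l<n. A k l * r l)" for k
  have Ar: "Ar k = B s s * r k + (\<Sum>j<s. b j * u j k)" if "k < n" for k
    unfolding Ar_def by (rule Apr[OF that b_def])
  have b0: "b j = 0" if j: "j < s" for j
  proof -
    have "coord_inner n Ar (u j) = (\<Sum>k<n. \<Sum>l<n. A k l * r l * cnj (u j k))"
      by (simp add: coord_inner_def Ar_def sum_distrib_right)
    also have "\<dots> = (\<Sum>l<n. \<Sum>k<n. r l * cnj (A l k * u j k))"
    proof (subst sum.swap, intro sum.cong refl)
      fix l k assume "l \<in> {..<n}" "k \<in> {..<n}"
      then have "A k l = cnj (A l k)" using herm by blast
      then show "A k l * r l * cnj (u j k) = r l * cnj (A l k * u j k)" by simp
    qed
    also have "\<dots> = (\<Sum>l<n. r l * cnj (\<Sum>k<n. A l k * u j k))"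
      by (simp add: sum_distrib_left)
    also have "\<dots> = (\<Sum>l<n. r l * cnj (B j j * u j l))"
      using eig j by (intro sum.cong) auto
    also have "\<dots> = cnj (B j j) * coord_inner n r (u j)"
      by (simp add: coord_inner_def sum_distrib_left mult_ac)
    finally have 1: "coord_inner n Ar (u j) = 0" using r_orth[OF j] by simp
    have "coord_inner n Ar (u j) = coord_inner n ((\<lambda>k. B s s * r k) + (\<lambda>k. \<Sum>j<s. b j * u j k)) (u j)"
      by (rule coord_inner_cong) (simp_all add: Ar)
    also have "\<dots> = b j"
      unfolding coord.ip_add_left coord.ip_scale_left
      using r_orth[OF j] coord_inner_combination[OF orth j, of b] by simp
    finally show ?thesis using 1 by simp
  qed
  define \<rho> where "\<rho> = complex_of_real (sqrt (coord.sqnorm n r))"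
  have \<rho>: "\<rho> \<noteq> 0" "cnj \<rho> = \<rho>" "\<rho> * \<rho> = of_real (coord.sqnorm n r)"
    using pos by (simp_all add: \<rho>_def of_real_mult[symmetric] del: of_real_mult)
  define u' where "u' = u(s := (\<lambda>k. inverse \<rho> * r k))"
  have u's: "u' s = (\<lambda>k. inverse \<rho> * r k)" and u'j: "\<And>j. j < s \<Longrightarrow> u' j = u j"
    by (auto simp: u'_def)
  have "coord_inner n (u' s) (u' s) = 1"
    unfolding u's coord.ip_scale_left coord.ip_scale_right coord.ip_self using \<rho> pos
    by (simp add: field_simps)
  moreover have "coord_inner n (u' s) (u' j) = 0" if "j < s" for j
    unfolding u's coord.ip_scale_left u'j[OF that] using r_orth[OF that] by simp
  moreover from this have "coord_inner n (u' j) (u' s) = 0" if "j < s" for j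
    using that by (subst coord.ip_commute) simp
  ultimately have "\<forall>i<Suc s. \<forall>j<Suc s. coord_inner n (u' i) (u' j) = (if i = j then 1 else 0)"
    using orth u'j by (auto simp: less_Suc_eq)
  moreover have "\<forall>i<Suc s. \<forall>k<n. (\<Sum>l<n. A k l * u' i l) = B i i * u' i k"
  proof -
    have "(\<Sum>l<n. A k l * u' s l) = B s s * u' s k" if "k < n" for k
    proof -
      have "(\<Sum>l<n. A k l * u' s l) = inverse \<rho> * Ar k"
        by (simp add: u's Ar_def sum_distrib_left mult_ac)
      then show ?thesis using Ar[OF that] b0 by (simp add: u's)
    qed
    then show ?thesis using eig u'j by (auto simp: less_Suc_eq)
  qed
  moreover have "\<forall>j<Suc s. \<forall>m<n. j < m \<longrightarrow> (\<Sum>k<n. q m k * u' j k) = 0"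
  proof -
    have "(\<Sum>k<n. q m k * u' s k) = 0" if "m < n" "s < m" for m
    proof -
      have "(\<Sum>k<n. q m k * u' s k) = inverse \<rho> * (\<Sum>k<n. q m k * r k)"
        by (simp add: u's sum_distrib_left mult_ac)
      then show ?thesis using qr[of m] that by simp
    qed
    then show ?thesis using qu u'j by (auto simp: less_Suc_eq)
  qed
  moreover have "\<exists>c. \<forall>j<Suc s. \<forall>k<n. p j k = (\<Sum>i<Suc s. c j i * u' i k)"
  proof -
    define c' where "c' j i = (if j = s then (if i = s then \<rho> else a i) else if i = s then 0 else c j i)" for j i
    have "p j k = (\<Sum>i<Suc s. c' j i * u' i k)" if "j < Suc s" "k < n" for j k
    proof (cases "j = s")
      case True
      have "p s k = r k + (\<Sum>j<s. a j * u j k)" by (simp add: r_def)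
      then show ?thesis using True \<rho>(1) u'j by (simp add: c'_def u's)
    next
      case False
      then show ?thesis using that pu u'j by (simp add: c'_def)
    qed
    then show ?thesis by blast
  qed
  ultimately show ?case
    by - (rule exI[of _ u'], intro conjI)
qed

text \<open>
  The rows \<open>u i\<close> of a unitary matrix are the eigenvectors, and \<open>A = \<Sum>\<^sub>i e i u\<^sub>i u\<^sub>i\<^sup>*\<close>.  Orthonormality of
  the rows and of the columns is recorded separately: the first describes the eigenvectors, the second
  is Parseval's identity.
\<close>

definition unitarily_diagonalizes ::
    "nat \<Rightarrow> (nat \<Rightarrow> nat \<Rightarrow> complex) \<Rightarrow> (nat \<Rightarrow> real) \<Rightarrow> (nat \<Rightarrow> nat \<Rightarrow> complex) \<Rightarrow> bool" where
  "unitarily_diagonalizes n A e u \<longleftrightarrow>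
     (\<forall>i<n. \<forall>j<n. (\<Sum>k<n. u i k * cnj (u j k)) = (if i = j then 1 else 0)) \<and>
     (\<forall>k<n. \<forall>l<n. (\<Sum>i<n. u i k * cnj (u i l)) = (if k = l then 1 else 0)) \<and>
     (\<forall>k<n. \<forall>l<n. A k l = (\<Sum>i<n. of_real (e i) * u i k * cnj (u i l)))"

lemma orthonormal_rows_imp_columns:
  fixes u :: "nat \<Rightarrow> nat \<Rightarrow> complex"
  assumes rows: "\<And>i j. i < n \<Longrightarrow> j < n \<Longrightarrow> (\<Sum>k<n. u i k * cnj (u j k)) = (if i = j then 1 else 0)"
    and "k < n" "l < n"
  shows "(\<Sum>i<n. u i k * cnj (u i l)) = (if k = l then 1 else 0)"
proof -
  define U where "U = mat n n (\<lambda>(i, k). u i k)"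
  define V where "V = mat n n (\<lambda>(k, j). cnj (u j k))"
  have U: "U \<in> carrier_mat n n" and V: "V \<in> carrier_mat n n" by (simp_all add: U_def V_def)
  have "U * V = 1\<^sub>m n"
    by (rule eq_matI) (auto simp: U_def V_def scalar_prod_def lessThan_atLeast0[symmetric] rows)
  then have "V * U = 1\<^sub>m n" using mat_mult_left_right_inverse[OF U V] by simp
  then have "(V * U) $$ (l, k) = (if k = l then 1 else 0)"
    using assms by simp
  moreover have "(V * U) $$ (l, k) = (\<Sum>i<n. u i k * cnj (u i l))"
    using assms by (simp add: U_def V_def scalar_prod_def lessThan_atLeast0 mult.commute)
  ultimately show ?thesis by simp
qed

text \<open>
  The Schur form has the eigenvalues on its diagonal in any prescribed order, so the enumeration
  \<open>es\<close> is preserved.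
\<close>

lemma hermitian_unitarily_diagonalizable:
  fixes A :: "complex mat"
  assumes A: "A \<in> carrier_mat n n"
    and herm: "\<And>k l. k < n \<Longrightarrow> l < n \<Longrightarrow> A $$ (k, l) = cnj (A $$ (l, k))"
    and cp: "char_poly A = (\<Prod>e\<leftarrow>es. [:- e, 1:])" "length es = n"
  shows "\<exists>u. unitarily_diagonalizes n (\<lambda>k l. A $$ (k, l)) (\<lambda>i. Re (es ! i)) u"
proof -
  obtain B P Q where BPQ: "schur_decomposition A es = (B, P, Q)"
    by (metis surj_pair)
  from schur_decomposition[OF A cp(1) BPQ]
  have sim: "similar_mat_wit A B P Q" and ut: "upper_triangular B" and dB: "diag_mat B = es"
    by auto
  have PQ: "Q * P = 1\<^sub>m n" "A = P * B * Q"
    and car: "B \<in> carrier_mat n n" "P \<in> carrier_mat n n" "Q \<in> carrier_mat n n"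
    using similar_mat_witD2[OF A sim] by blast+
  have "A * P = P * B * (Q * P)"
    unfolding PQ(2) by (rule assoc_mult_mat) (use car in auto)
  then have AP: "A * P = P * B"
    unfolding PQ(1) using car by simp
  have dual: "(\<Sum>k<n. Q $$ (m, k) * P $$ (k, j)) = (if m = j then 1 else 0)" if "m < n" "j < n" for m j
    using arg_cong[OF PQ(1), of "\<lambda>M. M $$ (m, j)"] that car
    by (simp add: scalar_prod_def lessThan_atLeast0)
  have flag: "(\<Sum>l<n. A $$ (k, l) * P $$ (l, j)) = (\<Sum>i\<le>j. B $$ (i, j) * P $$ (k, i))"
    if "j < n" "k < n" for j k
  proof -
    have "(\<Sum>l<n. A $$ (k, l) * P $$ (l, j)) = (A * P) $$ (k, j)"
      using that car A by (simp add: scalar_prod_def lessThan_atLeast0)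
    also have "\<dots> = (\<Sum>i<n. P $$ (k, i) * B $$ (i, j))"
      unfolding AP using that car by (simp add: scalar_prod_def lessThan_atLeast0)
    also have "\<dots> = (\<Sum>i\<le>j. P $$ (k, i) * B $$ (i, j))"
      using upper_triangularD[OF ut] car that by (intro sum.mono_neutral_right) auto
    finally show ?thesis by (simp add: mult.commute)
  qed
  have "\<exists>u. (\<forall>i<n. \<forall>j<n. coord_inner n (u i) (u j) = (if i = j then 1 else 0)) \<and>
             (\<forall>i<n. \<forall>k<n. (\<Sum>l<n. A $$ (k, l) * u i l) = B $$ (i, i) * u i k) \<and>
             (\<forall>j<n. \<forall>m<n. j < m \<longrightarrow> (\<Sum>k<n. Q $$ (m, k) * u j k) = 0) \<and>
             (\<exists>c. \<forall>j<n. \<forall>k<n. P $$ (k, j) = (\<Sum>i<n. c j i * u i k))"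
    by (rule hermitian_flag_eigenvectors[where A = "\<lambda>k l. A $$ (k, l)"])
      (fact herm, fact dual, fact flag, simp)
  then obtain u where u:
      "\<forall>i<n. \<forall>j<n. coord_inner n (u i) (u j) = (if i = j then 1 else 0)"
      "\<forall>i<n. \<forall>k<n. (\<Sum>l<n. A $$ (k, l) * u i l) = B $$ (i, i) * u i k"
    by (elim exE conjE) (rule that)
  have rows: "\<And>i j. i < n \<Longrightarrow> j < n \<Longrightarrow> (\<Sum>k<n. u i k * cnj (u j k)) = (if i = j then 1 else 0)"
    using u(1) by (simp add: coord_inner_def)
  have eig: "\<And>i k. i < n \<Longrightarrow> k < n \<Longrightarrow> (\<Sum>l<n. A $$ (k, l) * u i l) = B $$ (i, i) * u i k"
    using u(2) by simp
  have Bes: "B $$ (i, i) = es ! i" if "i < n" for i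
    using dB that car(1) by (auto simp: diag_mat_def)
  have es_real: "of_real (Re (es ! i)) = es ! i" if i: "i < n" for i
  proof -
    have es: "es ! i = (\<Sum>k<n. \<Sum>l<n. A $$ (k, l) * u i l * cnj (u i k))"
    proof -
      have "(\<Sum>k<n. \<Sum>l<n. A $$ (k, l) * u i l * cnj (u i k))
          = (\<Sum>k<n. es ! i * u i k * cnj (u i k))"
        using eig[OF i] Bes[OF i] by (intro sum.cong) (auto simp: sum_distrib_right[symmetric])
      also have "\<dots> = es ! i * (\<Sum>k<n. u i k * cnj (u i k))"
        by (simp add: sum_distrib_left mult.assoc)
      finally show ?thesis using rows[OF i i] by simp
    qed
    have "cnj (es ! i) = (\<Sum>k<n. \<Sum>l<n. A $$ (l, k) * u i k * cnj (u i l))"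
      unfolding es cnj_sum
    proof (intro sum.cong refl)
      fix k l assume "k \<in> {..<n}" "l \<in> {..<n}"
      then have "A $$ (l, k) = cnj (A $$ (k, l))" using herm by blast
      then show "cnj (A $$ (k, l) * u i l * cnj (u i k)) = A $$ (l, k) * u i k * cnj (u i l)"
        by simp
    qed
    also have "\<dots> = es ! i" unfolding es by (rule sum.swap)
    finally have "es ! i \<in> \<real>" by (simp add: Reals_cnj_iff)
    then show ?thesis by simp
  qed
  have cols: "\<And>k l. k < n \<Longrightarrow> l < n \<Longrightarrow> (\<Sum>i<n. u i k * cnj (u i l)) = (if k = l then 1 else 0)"
    using orthonormal_rows_imp_columns[OF rows] by simp
  have "A $$ (k, l) = (\<Sum>i<n. of_real (Re (es ! i)) * u i k * cnj (u i l))" if "k < n" "l < n" for k l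
  proof -
    have "(\<Sum>i<n. of_real (Re (es ! i)) * u i k * cnj (u i l))
        = (\<Sum>i<n. \<Sum>m<n. A $$ (k, m) * u i m * cnj (u i l))"
      using eig Bes es_real that by (intro sum.cong) (auto simp: sum_distrib_right[symmetric])
    also have "\<dots> = (\<Sum>m<n. A $$ (k, m) * (\<Sum>i<n. u i m * cnj (u i l)))"
      by (subst sum.swap) (simp add: sum_distrib_left mult.assoc)
    also have "\<dots> = (\<Sum>m<n. if m = l then A $$ (k, l) else 0)"
      using cols that by (intro sum.cong) auto
    finally show ?thesis using that by simp
  qed
  then show ?thesis
    unfolding unitarily_diagonalizes_def using rows cols by blast
qed

lemma quadratic_form_diagonalized:
  assumes "unitarily_diagonalizes n A e u"
  shows "(\<Sum>k<n. \<Sum>l<n. A k l * x l * cnj (x k)) = of_real (\<Sum>i<n. e i * (cmod (coord_inner n x (u i)))\<^sup>2)"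
proof -
  have "(\<Sum>k<n. \<Sum>l<n. A k l * x l * cnj (x k))
      = (\<Sum>k<n. \<Sum>l<n. \<Sum>i<n. of_real (e i) * ((x l * cnj (u i l)) * (u i k * cnj (x k))))"
    using assms unfolding unitarily_diagonalizes_def
    by (intro sum.cong refl) (auto simp: sum_distrib_left sum_distrib_right mult_ac)
  also have "\<dots> = (\<Sum>k<n. \<Sum>i<n. \<Sum>l<n. of_real (e i) * ((x l * cnj (u i l)) * (u i k * cnj (x k))))"
    by (subst (2) sum.swap) simp
  also have "\<dots> = (\<Sum>i<n. \<Sum>k<n. \<Sum>l<n. of_real (e i) * ((x l * cnj (u i l)) * (u i k * cnj (x k))))"
    by (rule sum.swap)
  also have "\<dots> = (\<Sum>i<n. of_real (e i) * (coord_inner n x (u i) * coord_inner n (u i) x))"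
    unfolding coord_inner_def sum_product
    unfolding sum_distrib_left
    by (rule sum.cong[OF refl], rule sum.swap)
  finally show ?thesis
    by (simp add: coord.ip_mult_cnj)
qed

lemma eigenvalues_decreasing_diagonalizes:
  assumes A: "A \<in> carrier_mat n n"
    and herm: "\<And>k l. k < n \<Longrightarrow> l < n \<Longrightarrow> A $$ (k, l) = cnj (A $$ (l, k))"
    and e: "eigenvalues_decreasing A e"
  shows "\<exists>u. unitarily_diagonalizes n (\<lambda>k l. A $$ (k, l)) e u"
proof -
  let ?es = "map (\<lambda>i. complex_of_real (e i)) [0..<n]"
  have "char_poly A = (\<Prod>e\<leftarrow>?es. [:- e, 1:])"
    using e A by (simp add: eigenvalues_decreasing_def o_def interv_sum_list_conv_sum_set_nat
        prod.distinct_set_conv_list[symmetric] lessThan_atLeast0)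
  from hermitian_unitarily_diagonalizable[OF A herm this]
  obtain u where "unitarily_diagonalizes n (\<lambda>k l. A $$ (k, l)) (\<lambda>i. Re (?es ! i)) u" by auto
  then have "unitarily_diagonalizes n (\<lambda>k l. A $$ (k, l)) e u"
    by (simp add: unitarily_diagonalizes_def)
  then show ?thesis by blast
qed

lemma positive_semidefinite_diagonalization:
  assumes A: "A \<in> carrier_mat n n"
    and herm: "\<And>k l. k < n \<Longrightarrow> l < n \<Longrightarrow> A $$ (k, l) = cnj (A $$ (l, k))"
    and psd: "\<And>x. 0 \<le> Re (\<Sum>k<n. \<Sum>l<n. A $$ (k, l) * x l * cnj (x k))"
  shows "\<exists>e u. antimono_on {..<n} e \<and> (\<forall>i<n. 0 \<le> e i) \<and> unitarily_diagonalizes n (\<lambda>k l. A $$ (k, l)) e u"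
proof -
  obtain as where as: "char_poly A = (\<Prod>a\<leftarrow>as. [:- a, 1:])" "length as = n"
    using char_poly_factorized[OF A] by blast
  define es where "es = rev (sort_key Re as)"
  have "mset es = mset as" by (simp add: es_def)
  then have eq: "mset (map (\<lambda>a. [:- a, 1:]) as) = mset (map (\<lambda>a. [:- a, 1:]) es)" by simp
  have cp: "char_poly A = (\<Prod>a\<leftarrow>es. [:- a, 1:])"
    unfolding as(1) prod_mset_prod_list[symmetric] eq ..
  have len: "length es = n" by (simp add: es_def as)
  obtain u where u: "unitarily_diagonalizes n (\<lambda>k l. A $$ (k, l)) (\<lambda>i. Re (es ! i)) u"
    using hermitian_unitarily_diagonalizable[OF A herm cp len] by blast
  have "sorted_wrt (\<lambda>x y. Re x \<le> Re y) (sort_key Re as)"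
    using sorted_sort_key[of Re as] by (simp add: sorted_map)
  then have "sorted_wrt (\<lambda>x y. Re y \<le> Re x) es"
    by (simp add: es_def sorted_wrt_rev)
  then have "Re (es ! j) \<le> Re (es ! i)" if "i \<le> j" "j < n" for i j
    using that len sorted_wrt_nth_less[of "\<lambda>x y. Re y \<le> Re x" es i j]
    by (cases "i = j") auto
  then have "antimono_on {..<n} (\<lambda>i. Re (es ! i))"
    by (auto simp: monotone_on_def)
  moreover have "0 \<le> Re (es ! i)" if i: "i < n" for i
  proof -
    have "(\<Sum>j<n. Re (es ! j) * (cmod (coord_inner n (u i) (u j)))\<^sup>2) = (\<Sum>j<n. if j = i then Re (es ! i) else 0)"
      using u i by (intro sum.cong) (auto simp: unitarily_diagonalizes_def coord_inner_def)
    then show ?thesis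
      using psd[of "u i"] i unfolding quadratic_form_diagonalized[OF u] by simp
  qed
  ultimately show ?thesis using u by blast
qed

text \<open>
  Weyl's inequality.  For vectors \<open>\<surd>(e i) u i\<close> the form of the orthogonal family is the quadratic form
  of the matrix, and two such forms differ at \<open>x\<close> by at most \<open>\<parallel>x\<parallel>\<^sup>2\<close> times the sum of
  the absolute values of the entries of the difference of the matrices.
\<close>

lemma eigenvalue_perturbation:
  assumes e: "unitarily_diagonalizes n A e u" "antimono_on {..<n} e" "\<And>i. i < n \<Longrightarrow> 0 \<le> e i"
    and d: "unitarily_diagonalizes n B d v" "antimono_on {..<n} d" "\<And>i. i < n \<Longrightarrow> 0 \<le> d i"
    and i: "i < n"
  shows "e i \<le> d i + (\<Sum>k<n. \<Sum>l<n. cmod (A k l - B k l))"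
proof -
  obtain N where N: "n = Suc N" using i by (cases n) auto
  define \<eta> where "\<eta> = (\<Sum>k<n. \<Sum>l<n. cmod (A k l - B k l))"
  define scaled where "scaled e u i = (\<lambda>k. complex_of_real (sqrt (e i)) * u i k)"
    for e :: "nat \<Rightarrow> real" and u :: "nat \<Rightarrow> nat \<Rightarrow> complex" and i
  have frame: "(\<Sum>i<n. (cmod (coord_inner n x (scaled e u i)))\<^sup>2) = Re (\<Sum>k<n. \<Sum>l<n. A k l * x l * cnj (x k))"
    and orth: "i < n \<Longrightarrow> j < n \<Longrightarrow> i \<noteq> j \<Longrightarrow> coord_inner n (scaled e u i) (scaled e u j) = 0"
    and norm: "i < n \<Longrightarrow> coord.sqnorm n (scaled e u i) = e i"
    if "unitarily_diagonalizes n A e u" "\<And>i. i < n \<Longrightarrow> 0 \<le> e i" for A e u x i j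
  proof -
    show "(\<Sum>i<n. (cmod (coord_inner n x (scaled e u i)))\<^sup>2) = Re (\<Sum>k<n. \<Sum>l<n. A k l * x l * cnj (x k))"
      unfolding quadratic_form_diagonalized[OF that(1)] Re_complex_of_real scaled_def coord.ip_scale_right
      using that(2) by (intro sum.cong) (auto simp: norm_mult power_mult_distrib)
    have on: "i < n \<Longrightarrow> j < n \<Longrightarrow> coord_inner n (u i) (u j) = (if i = j then 1 else 0)" for i j
      using that(1) by (simp add: unitarily_diagonalizes_def coord_inner_def)
    show "i < n \<Longrightarrow> j < n \<Longrightarrow> i \<noteq> j \<Longrightarrow> coord_inner n (scaled e u i) (scaled e u j) = 0"
      unfolding scaled_def coord.ip_scale_right coord.ip_scale_left using on by simp
    show "i < n \<Longrightarrow> coord.sqnorm n (scaled e u i) = e i"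
      unfolding scaled_def coord.sqnorm_def coord.ip_scale_right coord.ip_scale_left
      using on that(2) by (simp flip: of_real_mult)
  qed
  have "coord.sqnorm n (scaled e u i) \<le> coord.sqnorm n (scaled d v i) + \<eta>"
  proof (rule coord.frame_comparison[where N = N and p = n])
    show "0 \<le> \<eta>" by (simp add: \<eta>_def sum_nonneg)
  next
    fix x
    have "(\<Sum>k\<le>N. (cmod (coord_inner n x (scaled e u k)))\<^sup>2)
        - (\<Sum>k<n. (cmod (coord_inner n x (scaled d v k)))\<^sup>2)
        = Re ((\<Sum>k<n. \<Sum>l<n. A k l * x l * cnj (x k)) - (\<Sum>k<n. \<Sum>l<n. B k l * x l * cnj (x k)))"
      using frame[OF e(1,3), of x] frame[OF d(1,3), of x] by (simp add: N lessThan_Suc_atMost)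
    also have "\<dots> = Re (\<Sum>k<n. \<Sum>l<n. (A k l - B k l) * x l * cnj (x k))"
      by (simp only: sum_subtractf left_diff_distrib)
    also have "\<dots> \<le> cmod (\<Sum>k<n. \<Sum>l<n. (A k l - B k l) * x l * cnj (x k))"
      by (rule complex_Re_le_cmod)
    also have "\<dots> \<le> (\<Sum>k<n. \<Sum>l<n. cmod (A k l - B k l) * (cmod (x l) * cmod (x k)))"
      by (intro sum_norm_le order.trans[OF norm_sum] sum_mono) (simp add: norm_mult)
    also have "\<dots> \<le> (\<Sum>k<n. \<Sum>l<n. cmod (A k l - B k l) * coord.sqnorm n x)"
    proof (intro sum_mono mult_left_mono)
      fix k l assume "k \<in> {..<n}" "l \<in> {..<n}"
      then have "(cmod (x k))\<^sup>2 \<le> coord.sqnorm n x" "(cmod (x l))\<^sup>2 \<le> coord.sqnorm n x"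
        unfolding coord_sqnorm by (auto intro!: member_le_sum)
      moreover have "2 * (cmod (x l) * cmod (x k)) \<le> (cmod (x l))\<^sup>2 + (cmod (x k))\<^sup>2"
        using sum_squares_bound[of "cmod (x l)" "cmod (x k)"] by simp
      ultimately show "cmod (x l) * cmod (x k) \<le> coord.sqnorm n x" by linarith
    qed simp
    finally show "(\<Sum>k\<le>N. (cmod (coord_inner n x (scaled e u k)))\<^sup>2)
        \<le> (\<Sum>k<n. (cmod (coord_inner n x (scaled d v k)))\<^sup>2) + \<eta> * coord.sqnorm n x"
      by (simp add: \<eta>_def sum_distrib_right)
  qed (use N i orth[OF e(1,3)] orth[OF d(1,3)] norm[OF e(1,3)] norm[OF d(1,3)] e(2) d(2)
      in \<open>auto simp: monotone_on_def\<close>)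
  then show ?thesis
    using norm[OF e(1,3)] norm[OF d(1,3)] i by (simp add: \<eta>_def)
qed

section \<open>Hilbert-Schmidt estimates and Gram matrices\<close>

interpretation hilbert: semi_inner_product "scaleC :: complex \<Rightarrow> 'h \<Rightarrow> 'h::complex_inner" cinner
proof
  fix x :: 'h
  show "0 \<le> Re (cinner x x)"
    by (simp flip: inner_eq_Re_cinner)
qed (simp_all add: cinner_add_left cinner_scaleC_left cinner_commute[symmetric])

lemma hilbert_sqnorm: "hilbert.sqnorm x = (norm x)\<^sup>2"
  by (simp add: hilbert.sqnorm_def power2_norm_eq_inner inner_eq_Re_cinner)

lemma cinner_self: "cinner x x = of_real ((norm x)\<^sup>2)"
  using hilbert.ip_self[of x] by (simp add: hilbert_sqnorm)

lemma norm_scaleC: "norm (c *\<^sub>C x) = cmod c * norm (x :: 'h::complex_inner)"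
proof -
  have "hilbert.sqnorm (c *\<^sub>C x) = (cmod c)\<^sup>2 * hilbert.sqnorm x"
    using hilbert.sqnorm_orthogonal_sum[of "{()}" "\<lambda>_. x" "\<lambda>_. c"] by simp
  then have "(norm (c *\<^sub>C x))\<^sup>2 = (cmod c * norm x)\<^sup>2"
    by (simp add: hilbert_sqnorm power_mult_distrib)
  then show ?thesis by simp
qed

lemma cmod_cinner_le: "cmod (cinner x y) \<le> norm x * norm (y :: 'h::complex_inner)"
proof (cases "cinner x y = 0")
  case False
  define c where "c = cnj (sgn (cinner x y))"
  have "c * cinner x y = of_real (cmod (cinner x y))"
    using False by (simp add: c_def sgn_eq complex_norm_square[symmetric] power2_eq_square
        mult.commute[of "cnj _"] flip: of_real_mult of_real_divide)
  then have "cmod (cinner x y) = inner (c *\<^sub>C x) y"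
    by (simp add: inner_eq_Re_cinner cinner_scaleC_left)
  also have "\<dots> \<le> norm (c *\<^sub>C x) * norm y" by (rule norm_cauchy_schwarz)
  also have "norm (c *\<^sub>C x) = norm x" using False by (simp add: norm_scaleC c_def norm_sgn)
  finally show ?thesis .
qed simp

text \<open>
  For \<open>T = \<Sum>\<^sub>k c k g\<^sub>k \<otimes> g\<^sub>k\<^sup>*\<close> the left-hand side is the squared Hilbert-Schmidt norm of \<open>T\<close>.  A unit
  vector \<open>h\<close> splits \<open>T\<close> into blocks; the three summands are the square of \<open>\<langle>T h, h\<rangle>\<close>, twice the squared
  norm of the part of \<open>T h\<close> orthogonal to \<open>h\<close>, and the squared norm of the compression of \<open>T\<close> to the
  complement of \<open>h\<close>.
\<close>

lemma hilbert_schmidt_split: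
  fixes g :: "'b \<Rightarrow> 'h::complex_inner" and c :: "'b \<Rightarrow> real"
  assumes h: "norm h = 1"
  defines "r \<equiv> \<lambda>k. g k - cinner (g k) h *\<^sub>C h"
  shows "(\<Sum>k\<in>I. \<Sum>l\<in>I. c k * c l * (cmod (cinner (g k) (g l)))\<^sup>2)
       = (\<Sum>k\<in>I. c k * (cmod (cinner h (g k)))\<^sup>2)\<^sup>2
         + 2 * (norm (\<Sum>k\<in>I. (of_real (c k) * cinner h (g k)) *\<^sub>C r k))\<^sup>2
         + (\<Sum>k\<in>I. \<Sum>l\<in>I. c k * c l * (cmod (cinner (r k) (r l)))\<^sup>2)"
proof -
  define \<beta> where "\<beta> k = cinner (g k) h" for k
  have \<beta>': "cinner h (g k) = cnj (\<beta> k)" for k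
    unfolding \<beta>_def by (rule cinner_commute)
  define X where "X k l = Re (\<beta> k * cnj (\<beta> l) * cinner (r l) (r k))" for k l
  have hh: "cinner h h = 1" using h by (simp add: cinner_self)
  have gr: "cinner (g k) (g l) = \<beta> k * cnj (\<beta> l) + cinner (r k) (r l)" for k l
    by (simp add: r_def hilbert.ip_diff_left hilbert.ip_diff_right hilbert.ip_scale_left
        hilbert.ip_scale_right hh \<beta>' flip: \<beta>_def)
  have sq: "(cmod (cinner (g k) (g l)))\<^sup>2 = (cmod (\<beta> k))\<^sup>2 * (cmod (\<beta> l))\<^sup>2
      + 2 * X k l + (cmod (cinner (r k) (r l)))\<^sup>2" for k l
  proof -
    have "(cmod (a + b))\<^sup>2 = (cmod a)\<^sup>2 + 2 * Re (a * cnj b) + (cmod b)\<^sup>2" for a b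
      by (simp only: cmod_power2) (simp add: power2_eq_square algebra_simps)
    from this[of "\<beta> k * cnj (\<beta> l)" "cinner (r k) (r l)"] show ?thesis
      unfolding gr X_def cinner_commute[of "r l" "r k"] by (simp add: norm_mult power_mult_distrib)
  qed
  define z where "z = (\<Sum>k\<in>I. (of_real (c k) * cinner h (g k)) *\<^sub>C r k)"
  have "cinner z z = (\<Sum>l\<in>I. \<Sum>k\<in>I. of_real (c k * c l) * (\<beta> k * cnj (\<beta> l) * cinner (r l) (r k)))"
    unfolding z_def hilbert.ip_sum_left hilbert.ip_scale_left
    by (simp add: hilbert.ip_sum_right hilbert.ip_scale_right \<beta>' sum_distrib_left mult_ac)
  then have z: "(norm z)\<^sup>2 = (\<Sum>k\<in>I. \<Sum>l\<in>I. c k * c l * X k l)"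
    unfolding X_def power2_norm_eq_inner inner_eq_Re_cinner
    by (subst sum.swap) (simp del: of_real_mult)
  have square: "(\<Sum>k\<in>I. c k * (cmod (cinner h (g k)))\<^sup>2)\<^sup>2
      = (\<Sum>k\<in>I. \<Sum>l\<in>I. c k * (cmod (\<beta> k))\<^sup>2 * (c l * (cmod (\<beta> l))\<^sup>2))"
    by (simp add: power2_eq_square[of "sum _ _"] sum_product \<beta>')
  have "(\<Sum>k\<in>I. \<Sum>l\<in>I. c k * c l * (cmod (cinner (g k) (g l)))\<^sup>2)
      = (\<Sum>k\<in>I. \<Sum>l\<in>I. c k * (cmod (\<beta> k))\<^sup>2 * (c l * (cmod (\<beta> l))\<^sup>2)
          + 2 * (c k * c l * X k l) + c k * c l * (cmod (cinner (r k) (r l)))\<^sup>2)"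
    by (intro sum.cong refl) (simp add: sq algebra_simps)
  also have "\<dots> = (\<Sum>k\<in>I. \<Sum>l\<in>I. c k * (cmod (\<beta> k))\<^sup>2 * (c l * (cmod (\<beta> l))\<^sup>2))
      + 2 * (\<Sum>k\<in>I. \<Sum>l\<in>I. c k * c l * X k l)
      + (\<Sum>k\<in>I. \<Sum>l\<in>I. c k * c l * (cmod (cinner (r k) (r l)))\<^sup>2)"
    unfolding sum.distrib by (simp only: sum_distrib_left[of 2])
  finally show ?thesis
    unfolding square z[unfolded z_def] .
qed

text \<open>
  Splitting off the direction of one of the vectors makes this vector zero, so repeated splitting
  exhausts the finitely many vectors and leaves a sum of nonnegative terms.
\<close>

lemma hilbert_schmidt_nonneg:
  fixes g :: "'b \<Rightarrow> 'h::complex_inner" and c :: "'b \<Rightarrow> real"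
  assumes "finite I"
  shows "0 \<le> (\<Sum>k\<in>I. \<Sum>l\<in>I. c k * c l * (cmod (cinner (g k) (g l)))\<^sup>2)"
proof (induction "card {k \<in> I. g k \<noteq> 0}" arbitrary: g rule: less_induct)
  case less
  show ?case
  proof (cases "\<exists>k\<in>I. g k \<noteq> 0")
    case False
    then show ?thesis by simp
  next
    case True
    then obtain j where j: "j \<in> I" "g j \<noteq> 0" by blast
    define h where "h = of_real (inverse (norm (g j))) *\<^sub>C g j"
    define r where "r = (\<lambda>k. g k - cinner (g k) h *\<^sub>C h)"
    have h1: "norm h = 1" using j by (simp add: h_def norm_scaleC norm_inverse)
    have "cinner (g j) h *\<^sub>C h = 1 *\<^sub>C g j"
      using j unfolding h_def scaleC_scaleC hilbert.ip_scale_right cinner_self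
      by (simp add: power2_eq_square field_simps)
    then have "r j = 0" by (simp add: r_def)
    moreover have "r k = 0" if "g k = 0" for k using that by (simp add: r_def)
    ultimately have "{k \<in> I. r k \<noteq> 0} \<subset> {k \<in> I. g k \<noteq> 0}" using j by auto
    then have "card {k \<in> I. r k \<noteq> 0} < card {k \<in> I. g k \<noteq> 0}"
      using assms by (intro psubset_card_mono) auto
    from less[OF this] show ?thesis
      unfolding hilbert_schmidt_split[OF h1, of c g I]
      by (intro add_nonneg_nonneg) (simp_all add: r_def)
  qed
qed

text \<open>
  The quadratic form of an operator is bounded by its Hilbert-Schmidt norm, because \<open>\<langle>T h, h\<rangle>\<^sup>2\<close> is one
  of the nonnegative summands of the splitting.
\<close>

lemma quadratic_form_le_hilbert_schmidt:
  fixes g :: "'b \<Rightarrow> 'h::complex_inner" and c :: "'b \<Rightarrow> real"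
  assumes "finite I"
  shows "\<bar>\<Sum>k\<in>I. c k * (cmod (cinner x (g k)))\<^sup>2\<bar>
    \<le> (norm x)\<^sup>2 * sqrt (\<Sum>k\<in>I. \<Sum>l\<in>I. c k * c l * (cmod (cinner (g k) (g l)))\<^sup>2)"
proof (cases "x = 0")
  case False
  define h where "h = of_real (inverse (norm x)) *\<^sub>C x"
  have h1: "norm h = 1" using False by (simp add: h_def norm_scaleC norm_inverse)
  have x: "x = of_real (norm x) *\<^sub>C h"
    using False by (simp add: h_def)
  have "(\<Sum>k\<in>I. c k * (cmod (cinner x (g k)))\<^sup>2) = (norm x)\<^sup>2 * (\<Sum>k\<in>I. c k * (cmod (cinner h (g k)))\<^sup>2)"
    by (subst x) (simp add: hilbert.ip_scale_left norm_mult power_mult_distrib sum_distrib_left mult_ac)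
  moreover have "(\<Sum>k\<in>I. c k * (cmod (cinner h (g k)))\<^sup>2)\<^sup>2
      \<le> (\<Sum>k\<in>I. \<Sum>l\<in>I. c k * c l * (cmod (cinner (g k) (g l)))\<^sup>2)"
    unfolding hilbert_schmidt_split[OF h1, of c g I]
    using hilbert_schmidt_nonneg[OF assms, of c "\<lambda>k. g k - cinner (g k) h *\<^sub>C h"] by simp
  then have "\<bar>\<Sum>k\<in>I. c k * (cmod (cinner h (g k)))\<^sup>2\<bar>
      \<le> sqrt (\<Sum>k\<in>I. \<Sum>l\<in>I. c k * c l * (cmod (cinner (g k) (g l)))\<^sup>2)"
    by (intro real_le_rsqrt) simp
  ultimately show ?thesis
    by (simp add: abs_mult mult_left_mono)
qed simp

text \<open>
  The Gram matrix and the operator \<open>\<Sum>\<^sub>k g\<^sub>k \<otimes> g\<^sub>k\<^sup>*\<close> have the same nonzero eigenvalues.  In terms of quadratic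
  forms: the unitary rotation of the family \<open>g\<close> by the eigenvectors of the Gram matrix leaves the form
  unchanged and makes the family orthogonal, with the eigenvalues as squared norms.
\<close>

lemma gram_eigenbasis_frame:
  fixes g :: "nat \<Rightarrow> 'h::complex_inner"
  assumes diag: "unitarily_diagonalizes n (\<lambda>k l. cinner (g k) (g l)) e u"
  defines "h \<equiv> \<lambda>i. \<Sum>k<n. cnj (u i k) *\<^sub>C g k"
  shows "\<And>i j. i < n \<Longrightarrow> j < n \<Longrightarrow> cinner (h i) (h j) = (if i = j then of_real (e i) else 0)"
    and "(\<Sum>i<n. (cmod (cinner x (h i)))\<^sup>2) = (\<Sum>k<n. (cmod (cinner x (g k)))\<^sup>2)"
proof -
  fix i j assume ij: "i < n" "j < n"
  have rows: "\<And>i j. i < n \<Longrightarrow> j < n \<Longrightarrow> (\<Sum>k<n. u i k * cnj (u j k)) = (if i = j then 1 else 0)"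
    and ex: "\<And>k l. k < n \<Longrightarrow> l < n \<Longrightarrow> cinner (g k) (g l) = (\<Sum>m<n. of_real (e m) * u m k * cnj (u m l))"
    using diag by (auto simp: unitarily_diagonalizes_def)
  have "cinner (h i) (h j) = (\<Sum>k<n. \<Sum>l<n. cnj (u i k) * u j l * cinner (g k) (g l))"
    unfolding h_def hilbert.ip_sum_left hilbert.ip_scale_left
    by (simp add: hilbert.ip_sum_right hilbert.ip_scale_right sum_distrib_left mult_ac)
  also have "\<dots> = (\<Sum>k<n. \<Sum>l<n. \<Sum>m<n. of_real (e m) * ((u m k * cnj (u i k)) * (u j l * cnj (u m l))))"
    by (intro sum.cong refl) (simp add: ex sum_distrib_left mult_ac)
  also have "\<dots> = (\<Sum>k<n. \<Sum>m<n. \<Sum>l<n. of_real (e m) * ((u m k * cnj (u i k)) * (u j l * cnj (u m l))))"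
    by (subst (2) sum.swap) simp
  also have "\<dots> = (\<Sum>m<n. \<Sum>k<n. \<Sum>l<n. of_real (e m) * ((u m k * cnj (u i k)) * (u j l * cnj (u m l))))"
    by (rule sum.swap)
  also have "\<dots> = (\<Sum>m<n. of_real (e m) * ((\<Sum>k<n. u m k * cnj (u i k)) * (\<Sum>l<n. u j l * cnj (u m l))))"
    unfolding sum_product unfolding sum_distrib_left ..
  also have "\<dots> = (\<Sum>m<n. if m = i then (if i = j then of_real (e i) else 0) else 0)"
    using rows ij by (intro sum.cong) auto
  finally show "cinner (h i) (h j) = (if i = j then of_real (e i) else 0)"
    using ij by simp
next
  have cols: "\<And>k l. k < n \<Longrightarrow> l < n \<Longrightarrow> (\<Sum>i<n. u i k * cnj (u i l)) = (if k = l then 1 else 0)"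
    using diag by (auto simp: unitarily_diagonalizes_def)
  define y where "y k = cinner x (g k)" for k
  have xh: "cinner x (h i) = (\<Sum>k<n. u i k * y k)" for i
    by (simp add: h_def y_def hilbert.ip_sum_right hilbert.ip_scale_right)
  have "complex_of_real (\<Sum>i<n. (cmod (cinner x (h i)))\<^sup>2) = (\<Sum>i<n. (\<Sum>k<n. u i k * y k) * cnj (\<Sum>l<n. u i l * y l))"
    unfolding of_real_sum xh by (simp only: complex_norm_square)
  also have "\<dots> = (\<Sum>i<n. \<Sum>k<n. \<Sum>l<n. y k * cnj (y l) * (u i k * cnj (u i l)))"
    by (simp add: sum_product mult_ac)
  also have "\<dots> = (\<Sum>k<n. \<Sum>i<n. \<Sum>l<n. y k * cnj (y l) * (u i k * cnj (u i l)))"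
    by (rule sum.swap)
  also have "\<dots> = (\<Sum>k<n. \<Sum>l<n. \<Sum>i<n. y k * cnj (y l) * (u i k * cnj (u i l)))"
    by (subst (2) sum.swap) simp
  also have "\<dots> = (\<Sum>k<n. \<Sum>l<n. if l = k then y k * cnj (y k) else 0)"
    using cols by (intro sum.cong refl) (auto simp flip: sum_distrib_left)
  also have "\<dots> = complex_of_real (\<Sum>k<n. (cmod (y k))\<^sup>2)"
    by (simp add: complex_norm_square del: of_real_power)
  finally show "(\<Sum>i<n. (cmod (cinner x (h i)))\<^sup>2) = (\<Sum>k<n. (cmod (cinner x (g k)))\<^sup>2)"
    unfolding y_def of_real_eq_iff .
qed

text \<open>
  The averaging operator \<open>(N + 1)\<^sup>-\<^sup>1 \<Sum>\<^sub>k g\<^sub>k \<otimes> g\<^sub>k\<^sup>*\<close> is compared with \<open>\<Sum>\<^sub>m w\<^sub>m \<otimes> w\<^sub>m\<^sup>*\<close>, where \<open>m \<le> p\<close>.  By \<open>inv\<close> the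
  mixed trace equals \<open>\<Sum>\<^sub>m \<parallel>w m\<parallel>\<^sup>4\<close>, which is also the squared Hilbert-Schmidt norm of the second operator.
  Hence only one copy of it is left, with a negative sign, in the squared norm of the difference.
\<close>

lemma gram_eigenvalue_error:
  fixes g w :: "nat \<Rightarrow> 'h::complex_inner"
  assumes orth: "\<And>m l. m \<noteq> l \<Longrightarrow> cinner (w m) (w l) = 0"
    and dec: "antimono (\<lambda>m. norm (w m))"
    and inv: "\<And>k m. cmod (cinner (g k) (w m)) = (norm (w m))\<^sup>2"
    and e: "unitarily_diagonalizes (Suc N) (\<lambda>k l. cinner (g k) (g l)) e u" "antimono_on {..N} e"
      "\<And>i. i \<le> N \<Longrightarrow> 0 \<le> e i"
    and i: "i \<le> N" "i \<le> p"
  shows "\<bar>e i / real (Suc N) - (norm (w i))\<^sup>2\<bar>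
    \<le> sqrt ((\<Sum>j\<le>N. \<Sum>k\<le>N. (cmod (cinner (g j) (g k)))\<^sup>2) / (real (Suc N))\<^sup>2 - (\<Sum>m\<le>p. norm (w m) ^ 4))"
    (is "_ \<le> sqrt ?T")
proof -
  let ?N = "real (Suc N)"
  define I where "I = {..N} <+> {..p}"
  define \<delta> where "\<delta> = 1 / ?N"
  have \<delta>: "\<delta> * ?N = 1" by (simp add: \<delta>_def del: of_nat_Suc)
  define c where "c = case_sum (\<lambda>_::nat. \<delta>) (\<lambda>_::nat. - 1 :: real)"
  \<comment> \<open>the signed weights encode the difference of the averaging operator and its limit; the
    expression \<open>?T\<close> is its squared Hilbert-Schmidt norm\<close>
  define G where "G = case_sum g w"
  have form: "(\<Sum>k\<in>I. c k * (cmod (cinner x (G k)))\<^sup>2)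
      = (\<Sum>k\<le>N. (cmod (cinner x (g k)))\<^sup>2) / ?N - (\<Sum>m\<le>p. (cmod (cinner x (w m)))\<^sup>2)" for x
  proof -
    have "(\<Sum>k\<in>I. c k * (cmod (cinner x (G k)))\<^sup>2)
        = \<delta> * (\<Sum>k\<le>N. (cmod (cinner x (g k)))\<^sup>2) - (\<Sum>m\<le>p. (cmod (cinner x (w m)))\<^sup>2)"
      unfolding I_def by (simp add: sum.Plus c_def G_def sum_negf sum_distrib_left)
    then show ?thesis by (simp add: \<delta>_def)
  qed
  have T: "(\<Sum>k\<in>I. \<Sum>l\<in>I. c k * c l * (cmod (cinner (G k) (G l)))\<^sup>2) = ?T"
  proof -
    have gw: "(cmod (cinner (g k) (w m)))\<^sup>2 = norm (w m) ^ 4" for k m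
      by (simp add: inv flip: power_mult)
    have wg: "(cmod (cinner (w m) (g k)))\<^sup>2 = norm (w m) ^ 4" for k m
      using gw[of k m] cinner_commute[of "w m" "g k"] by simp
    have "(\<Sum>l\<le>p. (cmod (cinner (w m) (w l)))\<^sup>2) = (\<Sum>l\<le>p. if l = m then norm (w m) ^ 4 else 0)" for m
      using orth by (intro sum.cong) (auto simp: cinner_self norm_power simp flip: power_mult)
    then have ww: "(\<Sum>m\<le>p. \<Sum>l\<le>p. (cmod (cinner (w m) (w l)))\<^sup>2) = (\<Sum>m\<le>p. norm (w m) ^ 4)"
      by simp
    have "(\<Sum>k\<in>I. \<Sum>l\<in>I. c k * c l * (cmod (cinner (G k) (G l)))\<^sup>2)
      = (\<Sum>j\<le>N. \<Sum>k\<le>N. \<delta> * \<delta> * (cmod (cinner (g j) (g k)))\<^sup>2)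
        + (\<Sum>k\<le>N. \<Sum>m\<le>p. - \<delta> * norm (w m) ^ 4) + (\<Sum>m\<le>p. \<Sum>k\<le>N. - \<delta> * norm (w m) ^ 4)
        + (\<Sum>m\<le>p. \<Sum>l\<le>p. (cmod (cinner (w m) (w l)))\<^sup>2)"
      unfolding I_def by (simp add: sum.Plus c_def G_def sum.distrib gw wg)
    also have "(\<Sum>m\<le>p. \<Sum>k\<le>N. - \<delta> * norm (w m) ^ 4) = (\<Sum>k\<le>N. \<Sum>m\<le>p. - \<delta> * norm (w m) ^ 4)"
      by (rule sum.swap)
    also have "\<dots> = - (\<delta> * ?N) * (\<Sum>m\<le>p. norm (w m) ^ 4)"
      unfolding sum_distrib_left[symmetric] by simp
    also have "(\<Sum>j\<le>N. \<Sum>k\<le>N. \<delta> * \<delta> * (cmod (cinner (g j) (g k)))\<^sup>2)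
        = (\<Sum>j\<le>N. \<Sum>k\<le>N. (cmod (cinner (g j) (g k)))\<^sup>2) / ?N\<^sup>2"
      unfolding sum_distrib_left[symmetric] by (simp add: \<delta>_def power2_eq_square del: of_nat_Suc)
    finally show ?thesis unfolding ww \<delta> by simp
  qed
  have close: "\<bar>(\<Sum>k\<le>N. (cmod (cinner x (g k)))\<^sup>2) / ?N - (\<Sum>m\<le>p. (cmod (cinner x (w m)))\<^sup>2)\<bar>
      \<le> sqrt ?T * hilbert.sqnorm x" for x
    using quadratic_form_le_hilbert_schmidt[of I c x G]
    unfolding form T hilbert_sqnorm by (simp add: I_def mult.commute)
  have T0: "0 \<le> sqrt ?T"
    unfolding T[symmetric] using hilbert_schmidt_nonneg[of I c G] by (simp add: I_def)
  define h where "h i = of_real (1 / sqrt ?N) *\<^sub>C (\<Sum>k<Suc N. cnj (u i k) *\<^sub>C g k)" for i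
  note frame = gram_eigenbasis_frame[OF e(1)]
  have h_orth: "cinner (h k) (h l) = 0" if "k \<le> N" "l \<le> N" "k \<noteq> l" for k l
    unfolding h_def hilbert.ip_scale_left hilbert.ip_scale_right
    using frame(1)[of k l] that by simp
  have h_norm: "hilbert.sqnorm (h k) = e k / ?N" if "k \<le> N" for k
  proof -
    have "cinner (\<Sum>j<Suc N. cnj (u k j) *\<^sub>C g j) (\<Sum>j<Suc N. cnj (u k j) *\<^sub>C g j) = of_real (e k)"
      using frame(1)[of k k] that by (simp del: sum.lessThan_Suc)
    then have "(norm (\<Sum>j<Suc N. cnj (u k j) *\<^sub>C g j))\<^sup>2 = e k"
      unfolding cinner_self of_real_eq_iff .
    then show ?thesis
      unfolding hilbert_sqnorm h_def norm_scaleC power_mult_distrib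
      by (simp add: norm_divide power_divide del: of_nat_Suc sum.lessThan_Suc)
  qed
  have h_form: "(\<Sum>k\<le>N. (cmod (cinner x (h k)))\<^sup>2) = (\<Sum>k\<le>N. (cmod (cinner x (g k)))\<^sup>2) / ?N" for x
  proof -
    have "(cmod (cinner x (h k)))\<^sup>2 = (cmod (cinner x (\<Sum>j<Suc N. cnj (u k j) *\<^sub>C g j)))\<^sup>2 / ?N" for k
      unfolding h_def hilbert.ip_scale_right
      by (simp add: norm_mult norm_divide power_mult_distrib power_divide del: of_nat_Suc sum.lessThan_Suc)
    then show ?thesis
      using frame(2)[of x] by (simp add: lessThan_Suc_atMost sum_divide_distrib[symmetric] del: of_nat_Suc)
  qed
  have w_dec: "hilbert.sqnorm (w l) \<le> hilbert.sqnorm (w k)" if "k \<le> l" for k l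
    using dec that unfolding hilbert_sqnorm by (auto simp: monotone_def intro!: power_mono)
  have h_dec: "hilbert.sqnorm (h l) \<le> hilbert.sqnorm (h k)" if "k \<le> l" "l \<le> N" for k l
    using e(2) that by (auto simp: h_norm monotone_on_def intro!: divide_right_mono)
  have "hilbert.sqnorm (h i) \<le> hilbert.sqnorm (w i) + sqrt ?T"
  proof (rule hilbert.frame_comparison[where N = N and p = "Suc p"])
    fix x show "(\<Sum>k\<le>N. (cmod (cinner x (h k)))\<^sup>2)
        \<le> (\<Sum>k<Suc p. (cmod (cinner x (w k)))\<^sup>2) + sqrt ?T * hilbert.sqnorm x"
      unfolding h_form lessThan_Suc_atMost using close[of x] by linarith
  qed (use h_orth orth h_dec w_dec i T0 in auto)
  moreover have "hilbert.sqnorm (w i) \<le> hilbert.sqnorm (h i) + sqrt ?T"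
  proof (rule hilbert.frame_comparison[where N = p and p = "Suc N"])
    fix x show "(\<Sum>k\<le>p. (cmod (cinner x (w k)))\<^sup>2)
        \<le> (\<Sum>k<Suc N. (cmod (cinner x (h k)))\<^sup>2) + sqrt ?T * hilbert.sqnorm x"
      unfolding h_form lessThan_Suc_atMost using close[of x] by linarith
  qed (use h_orth orth h_dec w_dec i T0 in auto)
  ultimately show ?thesis
    using h_norm[OF i(1)] by (simp add: hilbert_sqnorm abs_le_iff)
qed

text \<open>
  Under \<open>mean\<close> and \<open>sums\<close> the Hilbert-Schmidt error becomes arbitrarily small when first \<open>p\<close> and then
  \<open>N\<close> is chosen large.
\<close>

lemma gram_eigenvalue_limit:
  fixes g w :: "nat \<Rightarrow> 'h::complex_inner"
  assumes orth: "\<And>m l. m \<noteq> l \<Longrightarrow> cinner (w m) (w l) = 0"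
    and dec: "antimono (\<lambda>m. norm (w m))"
    and inv: "\<And>k m. cmod (cinner (g k) (w m)) = (norm (w m))\<^sup>2"
    and mean: "(\<lambda>N. (\<Sum>j\<le>N. \<Sum>k\<le>N. (cmod (cinner (g j) (g k)))\<^sup>2) / (real (Suc N))\<^sup>2) \<longlonglongrightarrow> s"
    and sums: "(\<lambda>m. norm (w m) ^ 4) sums s"
    and e: "\<And>N. unitarily_diagonalizes (Suc N) (\<lambda>k l. cinner (g k) (g l)) (e N) (u N)"
      "\<And>N. antimono_on {..N} (e N)" "\<And>N i. i \<le> N \<Longrightarrow> 0 \<le> e N i"
  shows "(\<lambda>N. e N i / real N) \<longlonglongrightarrow> (norm (w i))\<^sup>2"
proof -
  have "(\<lambda>N. e N i / real (Suc N)) \<longlonglongrightarrow> (norm (w i))\<^sup>2"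
  proof (rule LIMSEQ_I)
    fix \<epsilon> :: real assume \<epsilon>: "0 < \<epsilon>"
    have "(\<lambda>p. \<Sum>m\<le>p. norm (w m) ^ 4) \<longlonglongrightarrow> s"
      using sums by (simp add: sums_def_le)
    then have "\<forall>\<^sub>F p in sequentially. s - \<epsilon>\<^sup>2 / 2 < (\<Sum>m\<le>p. norm (w m) ^ 4)"
      by (rule order_tendstoD) (use \<epsilon> in simp)
    then have "\<forall>\<^sub>F p in sequentially. i \<le> p \<and> s - \<epsilon>\<^sup>2 / 2 < (\<Sum>m\<le>p. norm (w m) ^ 4)"
      by (intro eventually_conj eventually_ge_at_top)
    then have "\<exists>p. i \<le> p \<and> s - \<epsilon>\<^sup>2 / 2 < (\<Sum>m\<le>p. norm (w m) ^ 4)"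
      by (rule eventually_happens'[OF sequentially_bot])
    then obtain p where p: "i \<le> p" "s - \<epsilon>\<^sup>2 / 2 < (\<Sum>m\<le>p. norm (w m) ^ 4)" by blast
    have "\<forall>\<^sub>F N in sequentially.
        (\<Sum>j\<le>N. \<Sum>k\<le>N. (cmod (cinner (g j) (g k)))\<^sup>2) / (real (Suc N))\<^sup>2 < s + \<epsilon>\<^sup>2 / 2"
      using mean by (rule order_tendstoD) (use \<epsilon> in simp)
    then have "\<forall>\<^sub>F N in sequentially. norm (e N i / real (Suc N) - (norm (w i))\<^sup>2) < \<epsilon>"
      using eventually_ge_at_top[of i]
    proof eventually_elim
      case (elim N)
      let ?T = "(\<Sum>j\<le>N. \<Sum>k\<le>N. (cmod (cinner (g j) (g k)))\<^sup>2) / (real (Suc N))\<^sup>2 - (\<Sum>m\<le>p. norm (w m) ^ 4)"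
      have "\<bar>e N i / real (Suc N) - (norm (w i))\<^sup>2\<bar> \<le> sqrt ?T"
        by (rule gram_eigenvalue_error[OF orth dec inv e]) (use elim p in auto)
      also have "\<dots> < sqrt (\<epsilon>\<^sup>2)"
        using elim p by (intro real_sqrt_less_mono) linarith
      finally show ?case using \<epsilon> by simp
    qed
    then show "\<exists>N0. \<forall>N\<ge>N0. norm (e N i / real (Suc N) - (norm (w i))\<^sup>2) < \<epsilon>"
      by (simp add: eventually_sequentially)
  qed
  moreover have "(\<lambda>N. real (Suc N) / real N) \<longlonglongrightarrow> 1"
    using LIMSEQ_Suc_n_over_n by simp
  ultimately have "(\<lambda>N. e N i / real (Suc N) * (real (Suc N) / real N)) \<longlonglongrightarrow> (norm (w i))\<^sup>2 * 1"
    by (rule tendsto_mult)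
  then show ?thesis by (simp del: of_nat_Suc)
qed

section \<open>Wiener's theorem on the circle\<close>

lemma AE_singleton:
  assumes "AE t in M. P t" "{z} \<in> sets M" "emeasure M {z} \<noteq> 0"
  shows "P z"
proof (rule ccontr)
  assume "\<not> P z"
  obtain N where N: "{t \<in> space M. \<not> P t} \<subseteq> N" "emeasure M N = 0" "N \<in> sets M"
    using assms(1) by (rule AE_E)
  have "emeasure M {z} \<le> emeasure M N"
    using N assms(2) \<open>\<not> P z\<close> sets.sets_into_space[OF assms(2)] by (intro emeasure_mono) auto
  with N(2) assms(3) show False by simp
qed

locale circle_measure = finite_measure \<nu> for \<nu> :: "complex measure" +
  assumes sets_circle: "sets \<nu> = sets circle_borel"
begin

lemma space_circle: "space \<nu> = sphere 0 1"
  using sets_eq_imp_space_eq[OF sets_circle] by (simp add: circle_borel_def space_restrict_space)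

lemma singleton_in_sets: "z \<in> sphere 0 1 \<Longrightarrow> {z} \<in> sets \<nu>"
  unfolding sets_circle circle_borel_def by (auto simp: sets_restrict_space image_iff)

lemma atom_on_circle: "measure \<nu> {z} \<noteq> 0 \<Longrightarrow> z \<in> sphere 0 1"
  using measure_notin_sets[of "{z}" \<nu>] sets.sets_into_space[of "{z}" \<nu>]
  unfolding space_circle by auto

lemma borel_measurable_circle: "g \<in> borel_measurable borel \<Longrightarrow> g \<in> borel_measurable \<nu>"
  by (simp add: measurable_cong_sets[OF sets_circle refl] circle_borel_def measurable_restrict_space1)

lemma AE_atom:
  assumes "AE t in \<nu>. P t" "measure \<nu> {z} \<noteq> 0"
  shows "P z"
  using assms(1) singleton_in_sets[OF atom_on_circle[OF assms(2)]]
  by (rule AE_singleton) (use assms(2) in \<open>simp add: emeasure_eq_measure\<close>)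

lemma integral_indicator_singleton:
  "(\<integral>t. c * indicator {z} t \<partial>\<nu>) = c * complex_of_real (measure \<nu> {z})"
proof (cases "z \<in> sphere 0 1")
  case True
  have "(\<integral>t. c * indicator {z} t \<partial>\<nu>) = (\<integral>t. indicator {z} t *\<^sub>R c \<partial>\<nu>)"
    by (intro Bochner_Integration.integral_cong refl) (simp add: indicator_def)
  also have "\<dots> = measure \<nu> {z} *\<^sub>R c"
    using has_bochner_integral_indicator[OF singleton_in_sets[OF True], of c]
    by (intro has_bochner_integral_integral_eq) (simp add: emeasure_eq_measure)
  finally show ?thesis
    by (simp add: scaleR_conv_of_real mult.commute)
next
  case False
  have "(\<integral>t. c * indicator {z} t \<partial>\<nu>) = (\<integral>t. 0 \<partial>\<nu>)"
    using False by (intro Bochner_Integration.integral_cong) (auto simp: space_circle indicator_def)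
  then show ?thesis using False atom_on_circle[of z] by auto
qed

lemma integral_indicator_singleton_real:
  "(\<integral>t. c * indicator {z} t \<partial>\<nu>) = c * measure \<nu> {z}"
proof -
  have "complex_of_real (\<integral>t. c * indicator {z} t \<partial>\<nu>) = (\<integral>t. of_real c * indicator {z} t \<partial>\<nu>)"
    unfolding integral_complex_of_real[symmetric]
    by (intro Bochner_Integration.integral_cong) (auto simp: indicator_def)
  then show ?thesis
    unfolding integral_indicator_singleton of_real_mult[symmetric] of_real_eq_iff .
qed

text \<open>
  The integral of \<open>w \<mapsto> \<nu> {w}\<close> is the sum of the squares of the atoms, written with an enumeration \<open>x\<close> of
  a set of points that contains all of them.
\<close>

lemma integral_atom_weights_sums:
  fixes x :: "nat \<Rightarrow> complex"
  assumes inj: "inj_on x A" and atoms: "\<And>w. measure \<nu> {w} \<noteq> 0 \<Longrightarrow> w \<in> x ` A"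
  shows "(\<lambda>m. if m \<in> A then (measure \<nu> {x m})\<^sup>2 else 0) sums (\<integral>w. measure \<nu> {w} \<partial>\<nu>)"
proof -
  define a where "a m = (if m \<in> A then measure \<nu> {x m} else 0)" for m
  \<comment> \<open>the weights of the first \<open>p\<close> atoms exhaust the function \<open>w \<mapsto> \<nu> {w}\<close>\<close>
  define h where "h p w = (\<Sum>m<p. a m * indicator {x m} w)" for p w
  have ind: "(indicator {x m} :: complex \<Rightarrow> real) \<in> borel_measurable \<nu>" for m
    by (rule borel_measurable_circle) simp
  have int_ind: "integrable \<nu> (indicator {x m} :: complex \<Rightarrow> real)" for m
    by (rule integrable_const_bound[where B = 1, OF _ ind]) (simp add: indicator_def)
  have h_meas: "h p \<in> borel_measurable \<nu>" for p
    unfolding h_def[abs_def] using ind by (intro borel_measurable_sum borel_measurable_times) auto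
  have h_eq: "h p w = (if \<exists>m<p. m \<in> A \<and> x m = w then measure \<nu> {w} else 0)" for p w
  proof (cases "\<exists>m<p. m \<in> A \<and> x m = w")
    case True
    then obtain m0 where m0: "m0 < p" "m0 \<in> A" "x m0 = w" by blast
    have "h p w = (\<Sum>m<p. if m = m0 then measure \<nu> {w} else 0)"
      unfolding h_def using m0 inj by (intro sum.cong) (auto simp: a_def indicator_def dest: inj_onD)
    then show ?thesis using m0 by auto
  next
    case False
    then show ?thesis
      unfolding h_def by (subst sum.neutral) (auto simp: a_def indicator_def)
  qed
  have lim: "(\<lambda>p. h p w) \<longlonglongrightarrow> measure \<nu> {w}" for w
  proof (cases "measure \<nu> {w} = 0")
    case True
    then show ?thesis by (simp add: h_eq cong: if_cong)
  next
    case False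
    then obtain m where m: "m \<in> A" "x m = w" using atoms by blast
    have "\<forall>\<^sub>F p in sequentially. h p w = measure \<nu> {w}"
      using eventually_gt_at_top[of m] by eventually_elim (use m in \<open>auto simp: h_eq\<close>)
    then show ?thesis by (rule tendsto_eventually)
  qed
  have "(\<lambda>p. \<integral>w. h p w \<partial>\<nu>) \<longlonglongrightarrow> (\<integral>w. measure \<nu> {w} \<partial>\<nu>)"
  proof (rule integral_dominated_convergence[where w = "\<lambda>_. measure \<nu> (space \<nu>)"])
    show "(\<lambda>w. measure \<nu> {w}) \<in> borel_measurable \<nu>"
      using lim h_meas by (rule borel_measurable_LIMSEQ_real)
    show "AE w in \<nu>. norm (h p w) \<le> measure \<nu> (space \<nu>)" for p
      using bounded_measure by (auto simp: h_eq)
  qed (use lim h_meas in auto)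
  moreover have "(\<integral>w. h p w \<partial>\<nu>) = (\<Sum>m<p. if m \<in> A then (measure \<nu> {x m})\<^sup>2 else 0)" for p
  proof -
    have "(\<integral>w. h p w \<partial>\<nu>) = (\<Sum>m<p. \<integral>w. a m * indicator {x m} w \<partial>\<nu>)"
      unfolding h_def by (intro Bochner_Integration.integral_sum integrable_mult_right int_ind)
    also have "\<dots> = (\<Sum>m<p. if m \<in> A then (measure \<nu> {x m})\<^sup>2 else 0)"
      unfolding integral_indicator_singleton_real
      by (intro sum.cong refl) (simp add: a_def power2_eq_square)
    finally show ?thesis .
  qed
  ultimately show ?thesis by (simp add: sums_def)
qed

end

lemma circle_power_mean_limit:
  assumes "cmod \<zeta> = 1"
  shows "(\<lambda>N. (cmod (\<Sum>k\<le>N. \<zeta> ^ k) / real (Suc N))\<^sup>2) \<longlonglongrightarrow> (if \<zeta> = 1 then 1 else 0)"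
proof (cases "\<zeta> = 1")
  case True
  have "cmod (\<Sum>k\<le>N. \<zeta> ^ k) / real (Suc N) = 1" for N
    using True norm_of_nat[of "Suc N", where 'a = complex] by (simp del: of_nat_Suc norm_of_nat)
  then show ?thesis using True by (simp del: of_nat_Suc)
next
  case False
  have bound: "cmod (\<Sum>k\<le>N. \<zeta> ^ k) \<le> 2 / cmod (\<zeta> - 1)" for N
  proof -
    have "cmod (\<zeta> ^ Suc N - 1) \<le> cmod (\<zeta> ^ Suc N) + cmod 1" by (rule norm_triangle_ineq4)
    also have "\<dots> = 2" by (simp only: norm_power assms) simp
    finally show ?thesis
      using geometric_sum[OF False, of "Suc N"]
      by (simp add: lessThan_Suc_atMost norm_divide divide_right_mono del: power_Suc)
  qed
  have "(\<lambda>N. cmod (\<Sum>k\<le>N. \<zeta> ^ k) / real (Suc N)) \<longlonglongrightarrow> 0"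
  proof (rule tendsto_sandwich[OF _ _ tendsto_const])
    show "(\<lambda>N. 2 / cmod (\<zeta> - 1) / real (Suc N)) \<longlonglongrightarrow> 0"
      by (intro tendsto_divide_0[OF tendsto_const] filterlim_at_top_imp_at_infinity
          filterlim_compose[OF filterlim_real_sequentially filterlim_Suc])
    show "\<forall>\<^sub>F N in sequentially. cmod (\<Sum>k\<le>N. \<zeta> ^ k) / real (Suc N) \<le> 2 / cmod (\<zeta> - 1) / real (Suc N)"
      by (intro always_eventually allI divide_right_mono bound) simp
  qed simp
  then show ?thesis using False tendsto_power[of _ 0 _ 2] by fastforce
qed

context circle_measure
begin

definition fourier :: "nat \<Rightarrow> nat \<Rightarrow> complex" where
  "fourier j k = (\<integral>z. z ^ j * cnj (z ^ k) \<partial>\<nu>)"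

lemma integrable_trigonometric: "integrable \<nu> (\<lambda>z. c * (z ^ j * cnj (z ^ k)))"
proof (rule integrable_const_bound[where B = "cmod c"])
  show "AE z in \<nu>. norm (c * (z ^ j * cnj (z ^ k))) \<le> cmod c"
    by (rule AE_I2) (simp add: space_circle norm_mult norm_power)
  show "(\<lambda>z. c * (z ^ j * cnj (z ^ k))) \<in> borel_measurable \<nu>"
    by (rule borel_measurable_circle) (intro borel_measurable_continuous_onI continuous_intros)
qed

lemma norm_fourier_le: "cmod (fourier j k) \<le> measure \<nu> (space \<nu>)"
proof -
  have "cmod (fourier j k) \<le> (\<integral>z. cmod (1 * (z ^ j * cnj (z ^ k))) \<partial>\<nu>)"
    unfolding fourier_def using integral_norm_bound[of \<nu> "\<lambda>z. z ^ j * cnj (z ^ k)"] by simp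
  also have "\<dots> \<le> (\<integral>z. 1 \<partial>\<nu>)"
    by (intro integral_mono integrable_norm integrable_trigonometric)
      (simp_all add: space_circle norm_mult norm_power)
  finally show ?thesis by simp
qed

text \<open>
  Wiener's theorem.  The mean of the \<open>|fourier j k|\<^sup>2\<close> is the double integral of the squared modulus of
  the mean of the powers of \<open>z * cnj w\<close>, which tends to the indicator of the diagonal by
  \<open>circle_power_mean_limit\<close>.  Since the integrand is a finite sum of products of functions of \<open>z\<close> and
  of \<open>w\<close>, iterated integrals suffice and dominated convergence is used twice.
\<close>

lemma wiener_mean_square:
  "(\<lambda>N. (\<Sum>j\<le>N. \<Sum>k\<le>N. (cmod (fourier j k))\<^sup>2) / (real (Suc N))\<^sup>2) \<longlonglongrightarrow> (\<integral>w. measure \<nu> {w} \<partial>\<nu>)"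
proof -
  define P where "P N w = (\<integral>z. (cmod (\<Sum>k\<le>N. (z * cnj w) ^ k) / real (Suc N))\<^sup>2 \<partial>\<nu>)" for N w
  have expand: "complex_of_real ((cmod (\<Sum>k\<le>N. (z * cnj w) ^ k))\<^sup>2)
      = (\<Sum>j\<le>N. \<Sum>k\<le>N. (cnj (w ^ j) * w ^ k) * (z ^ j * cnj (z ^ k)))" for N z w
  proof -
    have "complex_of_real ((cmod (\<Sum>k\<le>N. (z * cnj w) ^ k))\<^sup>2)
        = (\<Sum>j\<le>N. \<Sum>k\<le>N. (z * cnj w) ^ j * cnj ((z * cnj w) ^ k))"
      by (simp only: complex_norm_square cnj_sum sum_product)
    then show ?thesis by (simp add: power_mult_distrib mult_ac)
  qed
  have P: "complex_of_real (P N w) = (\<Sum>j\<le>N. \<Sum>k\<le>N. (fourier j k / (of_nat (Suc N))\<^sup>2) * (w ^ k * cnj (w ^ j)))" for N w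
  proof -
    have "complex_of_real (P N w)
        = (\<integral>z. (\<Sum>j\<le>N. \<Sum>k\<le>N. (cnj (w ^ j) * w ^ k) * (z ^ j * cnj (z ^ k))) / (of_nat (Suc N))\<^sup>2 \<partial>\<nu>)"
      unfolding P_def integral_complex_of_real[symmetric] expand[symmetric]
      by (simp add: power_divide del: of_nat_Suc)
    also have "\<dots> = (\<Sum>j\<le>N. \<Sum>k\<le>N. (cnj (w ^ j) * w ^ k) * fourier j k) / (of_nat (Suc N))\<^sup>2"
      using integrable_trigonometric
      by (simp add: Bochner_Integration.integral_sum fourier_def del: of_nat_Suc complex_cnj_power)
    finally show ?thesis
      by (simp add: sum_divide_distrib mult_ac del: of_nat_Suc)
  qed
  have P_int: "(\<integral>w. P N w \<partial>\<nu>) = (\<Sum>j\<le>N. \<Sum>k\<le>N. (cmod (fourier j k))\<^sup>2) / (real (Suc N))\<^sup>2" for N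
  proof -
    have "cnj (fourier j k) = (\<integral>z. cnj (z ^ j * cnj (z ^ k)) \<partial>\<nu>)" for j k
      unfolding fourier_def by (rule Bochner_Integration.integral_cnj[symmetric])
    then have cnj_fourier: "cnj (fourier j k) = fourier k j" for j k
      by (simp add: fourier_def mult.commute)
    have "complex_of_real (\<integral>w. P N w \<partial>\<nu>)
        = (\<Sum>j\<le>N. \<Sum>k\<le>N. fourier j k / (of_nat (Suc N))\<^sup>2 * cnj (fourier j k))"
      unfolding integral_complex_of_real[symmetric] P using integrable_trigonometric
      by (simp add: Bochner_Integration.integral_sum cnj_fourier flip: fourier_def del: of_nat_Suc complex_cnj_power)
    also have "\<dots> = complex_of_real ((\<Sum>j\<le>N. \<Sum>k\<le>N. (cmod (fourier j k))\<^sup>2) / (real (Suc N))\<^sup>2)"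
      by (simp add: sum_divide_distrib del: of_nat_Suc flip: complex_norm_square)
    finally show ?thesis unfolding of_real_eq_iff .
  qed
  have P_meas: "P N \<in> borel_measurable \<nu>" for N
  proof -
    have "(\<lambda>w. Re (complex_of_real (P N w))) \<in> borel_measurable \<nu>"
      unfolding P by (rule borel_measurable_circle) (intro borel_measurable_continuous_onI continuous_intros)
    then show ?thesis by simp
  qed
  have mean_le: "(cmod (\<Sum>k\<le>N. (z * cnj w) ^ k) / real (Suc N))\<^sup>2 \<le> 1"
    if "z \<in> space \<nu>" "w \<in> space \<nu>" for N z w
  proof -
    have "cmod (\<Sum>k\<le>N. (z * cnj w) ^ k) \<le> (\<Sum>k\<le>N. 1)"
      using that by (intro sum_norm_le) (simp add: space_circle norm_power norm_mult)
    then have "cmod (\<Sum>k\<le>N. (z * cnj w) ^ k) / real (Suc N) \<le> 1"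
      by (simp add: field_simps)
    then show ?thesis by (intro power_le_one) auto
  qed
  have meas: "(\<lambda>z. (cmod (\<Sum>k\<le>N. (z * cnj w) ^ k) / real (Suc N))\<^sup>2) \<in> borel_measurable \<nu>" for N w
    by (rule borel_measurable_circle) (intro borel_measurable_continuous_onI continuous_intros, simp)
  have P_lim: "(\<lambda>N. P N w) \<longlonglongrightarrow> measure \<nu> {w}" if w: "w \<in> space \<nu>" for w
  proof -
    have "(\<lambda>N. P N w) \<longlonglongrightarrow> (\<integral>z. 1 * indicator {w} z \<partial>\<nu>)"
      unfolding P_def
    proof (rule integral_dominated_convergence[where w = "\<lambda>_. 1"])
      show "(\<lambda>z. 1 * indicator {w} z :: real) \<in> borel_measurable \<nu>"
        by (rule borel_measurable_circle) simp
      show "AE z in \<nu>. (\<lambda>N. (cmod (\<Sum>k\<le>N. (z * cnj w) ^ k) / real (Suc N))\<^sup>2) \<longlonglongrightarrow> 1 * indicator {w} z"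
      proof (rule AE_I2)
        fix z assume z: "z \<in> space \<nu>"
        have "w * cnj w = 1" using w complex_norm_square[of w] by (simp add: space_circle)
        then have "z * cnj w = 1 \<longleftrightarrow> z = w"
          by (metis mult.commute mult.left_commute mult.right_neutral)
        then have ind: "(if z * cnj w = 1 then 1 else 0) = (1 * indicator {w} z :: real)"
          by (simp add: indicator_def)
        have "cmod (z * cnj w) = 1"
          using w z by (simp add: space_circle norm_mult)
        from circle_power_mean_limit[OF this] show "(\<lambda>N. (cmod (\<Sum>k\<le>N. (z * cnj w) ^ k) / real (Suc N))\<^sup>2) \<longlonglongrightarrow> 1 * indicator {w} z"
          unfolding ind .
      qed
      show "AE z in \<nu>. norm ((cmod (\<Sum>k\<le>N. (z * cnj w) ^ k) / real (Suc N))\<^sup>2) \<le> 1" for N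
        using mean_le w by (intro AE_I2) simp
    qed (use meas in auto)
    then show ?thesis unfolding integral_indicator_singleton_real by simp
  qed
  have "(\<lambda>N. \<integral>w. P N w \<partial>\<nu>) \<longlonglongrightarrow> (\<integral>w. measure \<nu> {w} \<partial>\<nu>)"
  proof (rule integral_dominated_convergence[where w = "\<lambda>_. measure \<nu> (space \<nu>)"])
    show "(\<lambda>w. measure \<nu> {w}) \<in> borel_measurable \<nu>"
      using P_lim P_meas by (rule borel_measurable_LIMSEQ_real)
    show "AE w in \<nu>. norm (P N w) \<le> measure \<nu> (space \<nu>)" for N
    proof (rule AE_I2)
      fix w assume w: "w \<in> space \<nu>"
      have "P N w \<le> (\<integral>z. 1 \<partial>\<nu>)"
        unfolding P_def using mean_le[OF _ w] meas
        by (intro integral_mono integrable_const_bound[where B = 1]) auto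
      moreover have "0 \<le> P N w" unfolding P_def by simp
      ultimately show "norm (P N w) \<le> measure \<nu> (space \<nu>)" by simp
    qed
  qed (use P_lim P_meas in auto)
  then show ?thesis unfolding P_int .
qed

end

section \<open>Isometries and unilateral shifts\<close>

lemma bounded_bilinear_cinner: "bounded_bilinear (cinner :: 'h::complex_inner \<Rightarrow> 'h \<Rightarrow> complex)"
proof
  show "\<exists>C. \<forall>x y :: 'h. norm (cinner x y) \<le> norm x * norm y * C"
    using cmod_cinner_le by (intro exI[of _ 1]) auto
qed (simp_all add: hilbert.ip_add_left hilbert.ip_add_right hilbert.ip_scale_left hilbert.ip_scale_right
    scaleR_scaleC scaleR_conv_of_real)

lemmas tendsto_cinner = bounded_bilinear.tendsto[OF bounded_bilinear_cinner]

text \<open>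
  Identities that are linear and continuous in a vector extend from a set of generators to its
  closed linear span.
\<close>

lemma closure_cspan_induct [consumes 1, case_names base zero add scale limit]:
  fixes X :: "'h::complex_inner set"
  assumes x: "x \<in> closure (cspan X)"
    and base: "\<And>u. u \<in> X \<Longrightarrow> P u"
    and zero: "P 0"
    and add: "\<And>u v. u \<in> closure (cspan X) \<Longrightarrow> v \<in> closure (cspan X) \<Longrightarrow> P u \<Longrightarrow> P v \<Longrightarrow> P (u + v)"
    and scale: "\<And>c u. u \<in> closure (cspan X) \<Longrightarrow> P u \<Longrightarrow> P (c *\<^sub>C u)"
    and limit: "\<And>s l. (\<And>n. s n \<in> closure (cspan X)) \<Longrightarrow> l \<in> closure (cspan X) \<Longrightarrow> (\<And>n. P (s n)) \<Longrightarrow>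
      s \<longlonglongrightarrow> l \<Longrightarrow> P l"
  shows "P x"
proof -
  have sub: "u \<in> cspan X \<Longrightarrow> u \<in> closure (cspan X)" for u
    using closure_subset by blast
  have span: "u \<in> cspan X \<and> P u" if "u \<in> cspan X" for u
    using that
  proof (induction rule: complex_vector.span_induct_alt)
    case base
    then show ?case using zero by (simp add: complex_vector.span_zero)
  next
    case (step c u v)
    have "u \<in> cspan X" using step by (simp add: complex_vector.span_base)
    then have "P (c *\<^sub>C u)" "c *\<^sub>C u \<in> cspan X"
      using step base scale sub by (auto intro: complex_vector.span_scale)
    then show ?case
      using step add sub by (auto intro: complex_vector.span_add)
  qed
  obtain s where "\<And>n. s n \<in> cspan X" "s \<longlonglongrightarrow> x"
    using x unfolding closure_sequential by blast
  then show ?thesis using limit[of s x] span sub x by blast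
qed

locale isometry_on =
  fixes S :: "'h::complex_inner set" and K :: "'h \<Rightarrow> 'h"
  assumes subspace: "csubspace S"
    and invariant: "x \<in> S \<Longrightarrow> K x \<in> S"
    and map_add: "x \<in> S \<Longrightarrow> y \<in> S \<Longrightarrow> K (x + y) = K x + K y"
    and map_scale: "x \<in> S \<Longrightarrow> K (c *\<^sub>C x) = c *\<^sub>C K x"
    and preserves: "x \<in> S \<Longrightarrow> y \<in> S \<Longrightarrow> cinner (K x) (K y) = cinner x y"
begin

lemma power_invariant: "x \<in> S \<Longrightarrow> (K ^^ r) x \<in> S"
  by (induction r) (auto intro: invariant)

lemma power_add: "x \<in> S \<Longrightarrow> y \<in> S \<Longrightarrow> (K ^^ r) (x + y) = (K ^^ r) x + (K ^^ r) y"
  by (induction r) (auto simp: map_add power_invariant)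

lemma power_scale: "x \<in> S \<Longrightarrow> (K ^^ r) (c *\<^sub>C x) = c *\<^sub>C (K ^^ r) x"
  by (induction r) (auto simp: map_scale power_invariant)

lemma power_preserves: "x \<in> S \<Longrightarrow> y \<in> S \<Longrightarrow> cinner ((K ^^ r) x) ((K ^^ r) y) = cinner x y"
  by (induction r) (auto simp: preserves power_invariant)

lemma power_norm: "x \<in> S \<Longrightarrow> norm ((K ^^ r) x) = norm x"
  using power_preserves[of x x r] by (simp add: cinner_self del: of_real_power)

lemma power_norm_diff:
  assumes "x \<in> S" "y \<in> S"
  shows "norm ((K ^^ r) x - (K ^^ r) y) = norm (x - y)"
proof -
  have "cinner ((K ^^ r) x - (K ^^ r) y) ((K ^^ r) x - (K ^^ r) y) = cinner (x - y) (x - y)"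
    using assms by (simp add: hilbert.ip_diff_left hilbert.ip_diff_right power_preserves)
  then show ?thesis by (simp add: cinner_self del: of_real_power)
qed

text \<open>
  The moduli of the correlations along the orbit of an isometry depend only on the time lag.  The
  absolute difference of the natural numbers \<open>j\<close> and \<open>k\<close> is written \<open>max j k - min j k\<close>.
\<close>

lemma cinner_powers:
  assumes "x \<in> S"
  shows "cmod (cinner ((K ^^ j) x) ((K ^^ k) x)) = cmod (cinner ((K ^^ (max j k - min j k)) x) x)"
proof -
  have le: "cinner ((K ^^ j) x) ((K ^^ k) x) = cinner ((K ^^ (j - k)) x) x" if "k \<le> j" for j k
    using power_preserves[OF power_invariant[OF assms, of "j - k"] assms, of k] that
    by (simp flip: funpow_add[THEN fun_cong, unfolded o_apply])
  show ?thesis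
  proof (cases "k \<le> j")
    case True
    then show ?thesis using le by (simp add: max_def min_def)
  next
    case False
    then have "cmod (cinner ((K ^^ j) x) ((K ^^ k) x)) = cmod (cinner ((K ^^ k) x) ((K ^^ j) x))"
      by (metis cinner_commute complex_mod_cnj)
    then show ?thesis using False le[of j k] by (simp add: max_def min_def)
  qed
qed

end

text \<open>
  The interchange of limits by which convergence to zero extends to limit points: the functions
  \<open>T r\<close> are Lipschitz at \<open>l\<close> with a constant independent of \<open>r\<close>.
\<close>

lemma tendsto_zero_uniform_limit:
  fixes T :: "nat \<Rightarrow> 'h::real_normed_vector \<Rightarrow> complex"
  assumes lip: "\<And>n r. cmod (T r l - T r (s n)) \<le> C * norm (l - s n)"
    and s: "s \<longlonglongrightarrow> l" and T: "\<And>n. (\<lambda>r. T r (s n)) \<longlonglongrightarrow> 0"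
  shows "(\<lambda>r. T r l) \<longlonglongrightarrow> 0"
proof (rule LIMSEQ_I)
  fix \<epsilon> :: real assume \<epsilon>: "0 < \<epsilon>"
  have "(\<lambda>n. C * norm (l - s n)) \<longlonglongrightarrow> C * norm (l - l)"
    by (intro tendsto_intros s)
  then have "\<forall>\<^sub>F n in sequentially. C * norm (l - s n) < \<epsilon> / 2"
    using \<epsilon> by (intro order_tendstoD) auto
  then have "\<exists>n. C * norm (l - s n) < \<epsilon> / 2"
    by (rule eventually_happens'[OF sequentially_bot])
  then obtain n where n: "C * norm (l - s n) < \<epsilon> / 2" by blast
  from LIMSEQ_D[OF T[of n], of "\<epsilon> / 2"] \<epsilon>
  obtain R where R: "\<And>r. r \<ge> R \<Longrightarrow> cmod (T r (s n)) < \<epsilon> / 2" by auto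
  have "cmod (T r l - 0) < \<epsilon>" if "r \<ge> R" for r
    using norm_triangle_ineq[of "T r l - T r (s n)" "T r (s n)"] lip[of r n] n R[OF that] by simp
  then show "\<exists>R. \<forall>r\<ge>R. cmod (T r l - 0) < \<epsilon>" by blast
qed

lemma unilateral_shifts_isometry_on:
  assumes shifts: "sum_of_unilateral_shifts_on S K"
    and sub: "csubspace S" and inv: "\<And>x. x \<in> S \<Longrightarrow> K x \<in> S"
    and add: "\<And>x y. x \<in> S \<Longrightarrow> y \<in> S \<Longrightarrow> K (x + y) = K x + K y"
    and scale: "\<And>c x. x \<in> S \<Longrightarrow> K (c *\<^sub>C x) = c *\<^sub>C K x"
    and cont: "continuous_on S K"
  shows "isometry_on S K"
proof -
  obtain B where on: "\<And>b c m n. b \<in> B \<Longrightarrow> c \<in> B \<Longrightarrow>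
        cinner ((K ^^ m) b) ((K ^^ n) c) = (if b = c \<and> m = n then 1 else 0)"
    and S: "S = closure (cspan {(K ^^ m) b | m b. b \<in> B})"
    using shifts unfolding sum_of_unilateral_shifts_on_def by blast
  let ?X = "{(K ^^ m) b | m b. b \<in> B}"
  have K0: "K 0 = 0"
    using scale[of 0 0] complex_vector.subspace_0[OF sub] by simp
  have lim: "(\<lambda>n. K (s n)) \<longlonglongrightarrow> K l" if "\<And>n. s n \<in> S" "l \<in> S" "s \<longlonglongrightarrow> l" for s l
    using continuous_on_tendsto_compose[OF cont that(3,2)] that(1) by simp
  have base: "cinner (K u) (K v) = cinner u v" if "u \<in> ?X" "v \<in> ?X" for u v
  proof -
    from that(1) obtain m b where u: "u = (K ^^ m) b" "b \<in> B" by blast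
    from that(2) obtain n c where v: "v = (K ^^ n) c" "c \<in> B" by blast
    show ?thesis using u v on[of b c "Suc m" "Suc n"] on[of b c m n] by simp
  qed
  have half: "cinner (K u) (K y) = cinner u y" if u: "u \<in> ?X" and y: "y \<in> S" for u y
    using y unfolding S
  proof (induction rule: closure_cspan_induct)
    case (limit s l)
    have "(\<lambda>n. cinner (K u) (K (s n))) \<longlonglongrightarrow> cinner (K u) (K l)"
      using limit by (intro tendsto_cinner tendsto_const lim) (auto simp: S)
    moreover have "(\<lambda>n. cinner (K u) (K (s n))) \<longlonglongrightarrow> cinner u l"
      using limit by (auto intro: tendsto_cinner tendsto_const)
    ultimately show ?case by (rule LIMSEQ_unique)
  qed (use base u in \<open>auto simp: K0 add scale hilbert.ip_add_right hilbert.ip_scale_right simp flip: S\<close>)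
  have full: "cinner (K x) (K y) = cinner x y" if x: "x \<in> S" and y: "y \<in> S" for x y
    using x unfolding S
  proof (induction rule: closure_cspan_induct)
    case (limit s l)
    have "(\<lambda>n. cinner (K (s n)) (K y)) \<longlonglongrightarrow> cinner (K l) (K y)"
      using limit by (intro tendsto_cinner tendsto_const lim) (auto simp: S)
    moreover have "(\<lambda>n. cinner (K (s n)) (K y)) \<longlonglongrightarrow> cinner l y"
      using limit by (auto intro: tendsto_cinner tendsto_const)
    ultimately show ?case by (rule LIMSEQ_unique)
  qed (use half y in \<open>auto simp: K0 add scale hilbert.ip_add_left hilbert.ip_scale_left simp flip: S\<close>)
  show ?thesis
    by unfold_locales (use sub inv add scale full in auto)
qed

text \<open>
  A high power of a shift moves every basis vector beyond any given one, so the correlations of basis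
  vectors vanish eventually; uniform boundedness of the powers extends this to the closed span.
\<close>

lemma unilateral_shifts_weakly_null:
  assumes iso: "isometry_on S K" and shifts: "sum_of_unilateral_shifts_on S K"
    and x: "x \<in> S" and y: "y \<in> S"
  shows "(\<lambda>r. cinner ((K ^^ r) x) y) \<longlonglongrightarrow> 0"
proof -
  interpret isometry_on S K by fact
  obtain B where on: "\<And>b c m n. b \<in> B \<Longrightarrow> c \<in> B \<Longrightarrow>
        cinner ((K ^^ m) b) ((K ^^ n) c) = (if b = c \<and> m = n then 1 else 0)"
    and S: "S = closure (cspan {(K ^^ m) b | m b. b \<in> B})"
    using shifts unfolding sum_of_unilateral_shifts_on_def by blast
  let ?X = "{(K ^^ m) b | m b. b \<in> B}"
  have XS: "u \<in> S" if "u \<in> ?X" for u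
    using that closure_subset[of "cspan ?X"] complex_vector.span_base[of u ?X] unfolding S by blast
  have zero: "(K ^^ r) 0 = 0" for r
    using power_scale[of 0 r 0] complex_vector.subspace_0[OF subspace] by simp
  have base: "(\<lambda>r. cinner ((K ^^ r) u) v) \<longlonglongrightarrow> 0" if "u \<in> ?X" "v \<in> ?X" for u v
  proof -
    from that(1) obtain m b where u: "u = (K ^^ m) b" "b \<in> B" by blast
    from that(2) obtain n c where v: "v = (K ^^ n) c" "c \<in> B" by blast
    have "cinner ((K ^^ r) u) v = 0" if "n < r" for r
      using on[OF u(2) v(2), of "r + m" n] that by (simp add: u(1) v(1) funpow_add)
    then have "\<forall>\<^sub>F r in sequentially. cinner ((K ^^ r) u) v = 0"
      using eventually_gt_at_top[of n] by (rule eventually_mono[rotated]) simp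
    then show ?thesis by (rule tendsto_eventually)
  qed
  have half: "(\<lambda>r. cinner ((K ^^ r) u) v) \<longlonglongrightarrow> 0" if u: "u \<in> ?X" and v: "v \<in> S" for u v
    using v unfolding S
  proof (induction rule: closure_cspan_induct)
    case (add v w)
    then show ?case using tendsto_add[of _ "0::complex" _ _ 0] by (simp add: hilbert.ip_add_right)
  next
    case (scale c v)
    then show ?case using tendsto_mult_right_zero[of _ _ "cnj c"] by (simp add: hilbert.ip_scale_right)
  next
    case (limit s l)
    show ?case
    proof (rule tendsto_zero_uniform_limit[of _ l s "norm u"])
      fix n r
      show "cmod (cinner ((K ^^ r) u) l - cinner ((K ^^ r) u) (s n)) \<le> norm u * norm (l - s n)"
        using cmod_cinner_le[of "(K ^^ r) u" "l - s n"] power_norm[OF XS[OF u], of r]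
        by (simp add: hilbert.ip_diff_right)
    qed (use limit in auto)
  qed (use base u in auto)
  show ?thesis
    using x unfolding S
  proof (induction rule: closure_cspan_induct)
    case zero
    then show ?case by (simp add: \<open>\<And>r. (K ^^ r) 0 = 0\<close>)
  next
    case (add v w)
    then show ?case using tendsto_add[of _ "0::complex" _ _ 0]
      by (simp add: hilbert.ip_add_left power_add flip: S)
  next
    case (scale c v)
    then show ?case using tendsto_mult_right_zero[of _ _ c]
      by (simp add: hilbert.ip_scale_left power_scale flip: S)
  next
    case (limit s l)
    show ?case
    proof (rule tendsto_zero_uniform_limit[of _ l s "norm y"])
      fix n r
      show "cmod (cinner ((K ^^ r) l) y - cinner ((K ^^ r) (s n)) y) \<le> norm y * norm (l - s n)"
        using cmod_cinner_le[of "(K ^^ r) l - (K ^^ r) (s n)" y] power_norm_diff[of l "s n" r] limit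
        by (simp add: hilbert.ip_diff_left mult.commute flip: S)
    qed (use limit in auto)
  qed (use half y in auto)
qed

section \<open>Vanishing means of correlations\<close>

lemma toeplitz_mean_tendsto_zero:
  fixes \<gamma> :: "nat \<Rightarrow> real"
  assumes lim: "\<gamma> \<longlonglongrightarrow> 0" and nonneg: "\<And>r. 0 \<le> \<gamma> r"
  shows "(\<lambda>N. (\<Sum>j\<le>N. \<Sum>k\<le>N. \<gamma> (max j k - min j k)) / (real (Suc N))\<^sup>2) \<longlonglongrightarrow> 0"
proof (rule LIMSEQ_I)
  fix \<epsilon> :: real assume \<epsilon>: "0 < \<epsilon>"
  obtain C where C: "\<And>r. \<gamma> r \<le> C" "0 < C"
    using Bseq_def[of \<gamma>] convergent_imp_Bseq[of \<gamma>] lim nonneg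
    by (auto simp: convergent_def)
  from LIMSEQ_D[OF lim, of "\<epsilon> / 2"] \<epsilon> nonneg
  obtain R where R: "\<And>r. r \<ge> R \<Longrightarrow> \<gamma> r \<le> \<epsilon> / 2" by (force intro: less_imp_le)
  \<comment> \<open>in a row at most \<open>2 * R + 1\<close> entries are near the diagonal; the others are small\<close>
  have row: "(\<Sum>k\<le>N. \<gamma> (max j k - min j k)) \<le> real (Suc N) * (\<epsilon> / 2) + C * real (2 * R + 1)" for N j
  proof -
    have "(\<Sum>k\<le>N. \<gamma> (max j k - min j k)) \<le> (\<Sum>k\<le>N. \<epsilon> / 2 + C * indicator {j - R..j + R} k)"
    proof (rule sum_mono)
      fix k
      show "\<gamma> (max j k - min j k) \<le> \<epsilon> / 2 + C * indicator {j - R..j + R} k"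
      proof (cases "k \<in> {j - R..j + R}")
        case True
        then show ?thesis using C(1)[of "max j k - min j k"] \<epsilon> by simp
      next
        case False
        then have "R \<le> max j k - min j k" by (auto simp: max_def min_def)
        then show ?thesis using R False by simp
      qed
    qed
    also have "\<dots> = real (Suc N) * (\<epsilon> / 2) + C * real (card ({..N} \<inter> {j - R..j + R}))"
    proof -
      have "(\<Sum>k\<le>N. indicator B k :: real) = real (card ({..N} \<inter> B))" for B
        by (simp add: indicator_def sum_of_bool_eq)
      then show ?thesis by (simp add: sum.distrib sum_distrib_left[symmetric])
    qed
    also have "card ({..N} \<inter> {j - R..j + R}) \<le> card {j - R..j + R}"
      by (intro card_mono) auto
    then have "card ({..N} \<inter> {j - R..j + R}) \<le> 2 * R + 1" by simp
    then have "C * real (card ({..N} \<inter> {j - R..j + R})) \<le> C * real (2 * R + 1)"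
      using C(2) by (intro mult_left_mono) auto
    finally show ?thesis by simp
  qed
  have bound: "(\<Sum>j\<le>N. \<Sum>k\<le>N. \<gamma> (max j k - min j k)) / (real (Suc N))\<^sup>2
      \<le> \<epsilon> / 2 + C * real (2 * R + 1) / real (Suc N)" for N
  proof -
    have "(\<Sum>j\<le>N. \<Sum>k\<le>N. \<gamma> (max j k - min j k)) \<le> (\<Sum>j\<le>N. real (Suc N) * (\<epsilon> / 2) + C * real (2 * R + 1))"
      by (intro sum_mono row)
    also have "\<dots> = real (Suc N) * (real (Suc N) * (\<epsilon> / 2) + C * real (2 * R + 1))" by simp
    finally show ?thesis
      by (simp add: power2_eq_square field_simps del: of_nat_Suc)
  qed
  have "(\<lambda>N. C * real (2 * R + 1) / real (Suc N)) \<longlonglongrightarrow> 0"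
    by (intro tendsto_divide_0[OF tendsto_const] filterlim_at_top_imp_at_infinity
          filterlim_compose[OF filterlim_real_sequentially filterlim_Suc])
  then have "\<forall>\<^sub>F N in sequentially. C * real (2 * R + 1) / real (Suc N) < \<epsilon> / 2"
    by (rule order_tendstoD) (use \<epsilon> in simp)
  then obtain N0 where N0: "\<And>N. N \<ge> N0 \<Longrightarrow> C * real (2 * R + 1) / real (Suc N) < \<epsilon> / 2"
    unfolding eventually_sequentially by blast
  have "norm ((\<Sum>j\<le>N. \<Sum>k\<le>N. \<gamma> (max j k - min j k)) / (real (Suc N))\<^sup>2 - 0) < \<epsilon>" if "N \<ge> N0" for N
  proof -
    have "0 \<le> (\<Sum>j\<le>N. \<Sum>k\<le>N. \<gamma> (max j k - min j k)) / (real (Suc N))\<^sup>2"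
      using nonneg by (intro divide_nonneg_nonneg sum_nonneg) auto
    then show ?thesis
      using bound[of N] N0[OF that] unfolding diff_zero real_norm_def by linarith
  qed
  then show "\<exists>N0. \<forall>N\<ge>N0. norm ((\<Sum>j\<le>N. \<Sum>k\<le>N. \<gamma> (max j k - min j k)) / (real (Suc N))\<^sup>2 - 0) < \<epsilon>"
    by blast
qed

text \<open>
  For bounded \<open>a\<close> and \<open>b\<close> the squares \<open>|a + b|\<^sup>2\<close> and \<open>|a|\<^sup>2\<close> differ by at most a constant times \<open>|b|\<close>.
\<close>

lemma mean_square_perturbation:
  fixes a b :: "nat \<Rightarrow> nat \<Rightarrow> complex"
  assumes bound: "\<And>j k. cmod (a j k) \<le> C" "\<And>j k. cmod (b j k) \<le> C"
    and a: "(\<lambda>N. (\<Sum>j\<le>N. \<Sum>k\<le>N. (cmod (a j k))\<^sup>2) / (real (Suc N))\<^sup>2) \<longlonglongrightarrow> s"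
    and b: "(\<lambda>N. (\<Sum>j\<le>N. \<Sum>k\<le>N. cmod (b j k)) / (real (Suc N))\<^sup>2) \<longlonglongrightarrow> 0"
  shows "(\<lambda>N. (\<Sum>j\<le>N. \<Sum>k\<le>N. (cmod (a j k + b j k))\<^sup>2) / (real (Suc N))\<^sup>2) \<longlonglongrightarrow> s"
proof -
  have pt: "\<bar>(cmod (a j k + b j k))\<^sup>2 - (cmod (a j k))\<^sup>2\<bar> \<le> 3 * C * cmod (b j k)" for j k
  proof -
    have "\<bar>(cmod (a j k + b j k))\<^sup>2 - (cmod (a j k))\<^sup>2\<bar>
        = \<bar>cmod (a j k + b j k) - cmod (a j k)\<bar> * (cmod (a j k + b j k) + cmod (a j k))"
      by (simp add: power2_eq_square square_diff_square_factored abs_mult mult.commute)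
    also have "\<dots> \<le> cmod (b j k) * (3 * C)"
    proof (rule mult_mono)
      show "\<bar>cmod (a j k + b j k) - cmod (a j k)\<bar> \<le> cmod (b j k)"
        using norm_triangle_ineq3[of "a j k + b j k" "a j k"] by simp
      show "cmod (a j k + b j k) + cmod (a j k) \<le> 3 * C"
        using norm_triangle_ineq[of "a j k" "b j k"] bound(1)[of j k] bound(2)[of j k] by linarith
    qed simp_all
    finally show ?thesis by (simp add: mult_ac)
  qed
  have "(\<lambda>N. (\<Sum>j\<le>N. \<Sum>k\<le>N. (cmod (a j k + b j k))\<^sup>2) / (real (Suc N))\<^sup>2
      - (\<Sum>j\<le>N. \<Sum>k\<le>N. (cmod (a j k))\<^sup>2) / (real (Suc N))\<^sup>2) \<longlonglongrightarrow> 0"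
  proof (rule Lim_null_comparison)
    show "(\<lambda>N. 3 * C * ((\<Sum>j\<le>N. \<Sum>k\<le>N. cmod (b j k)) / (real (Suc N))\<^sup>2)) \<longlonglongrightarrow> 0"
      using tendsto_mult_right_zero[OF b] .
    have "norm ((\<Sum>j\<le>N. \<Sum>k\<le>N. (cmod (a j k + b j k))\<^sup>2) / (real (Suc N))\<^sup>2
      - (\<Sum>j\<le>N. \<Sum>k\<le>N. (cmod (a j k))\<^sup>2) / (real (Suc N))\<^sup>2)
      \<le> 3 * C * ((\<Sum>j\<le>N. \<Sum>k\<le>N. cmod (b j k)) / (real (Suc N))\<^sup>2)" for N
    proof -
      have "\<bar>\<Sum>j\<le>N. \<Sum>k\<le>N. (cmod (a j k + b j k))\<^sup>2 - (cmod (a j k))\<^sup>2\<bar>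
          \<le> (\<Sum>j\<le>N. \<Sum>k\<le>N. 3 * C * cmod (b j k))"
        by (intro order.trans[OF sum_abs] sum_mono pt)
      then show ?thesis
        by (simp add: sum_subtractf sum_distrib_left[symmetric] diff_divide_distrib[symmetric]
            divide_right_mono del: of_nat_Suc)
    qed
    then show "\<forall>\<^sub>F N in sequentially. norm ((\<Sum>j\<le>N. \<Sum>k\<le>N. (cmod (a j k + b j k))\<^sup>2) / (real (Suc N))\<^sup>2
      - (\<Sum>j\<le>N. \<Sum>k\<le>N. (cmod (a j k))\<^sup>2) / (real (Suc N))\<^sup>2)
      \<le> 3 * C * ((\<Sum>j\<le>N. \<Sum>k\<le>N. cmod (b j k)) / (real (Suc N))\<^sup>2)"
      by simp
  qed
  from tendsto_add[OF this a] show ?thesis by simp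
qed

section \<open>Eigenvectors in the spectral representation\<close>

text \<open>
  The angles \<open>t\<close> with \<open>cis t = z\<close> differ by integer multiples of \<open>2 \<pi>\<close>, hence are countably many.
\<close>

lemma circle_lebesgue_singleton:
  assumes z: "z \<in> sphere 0 1"
  shows "{z} \<in> null_sets circle_lebesgue"
proof (rule null_setsI)
  have sets: "{z} \<in> sets circle_borel"
    using z unfolding circle_borel_def by (auto simp: sets_restrict_space image_iff)
  then show "{z} \<in> sets circle_lebesgue" by (simp add: circle_lebesgue_def)
  let ?R = "restrict_space lborel {0..<2 * pi}"
  let ?A = "cis -` {z} \<inter> space ?R"
  have "cis \<in> borel_measurable borel"
    by (intro borel_measurable_continuous_onI continuous_intros)
  then have cis: "cis \<in> measurable ?R circle_borel"
    unfolding circle_borel_def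
    by (intro measurable_restrict_space2 measurable_restrict_space1) auto
  have "countable {t. cis t = z}"
  proof (cases "\<exists>s. cis s = z")
    case True
    then obtain s where s: "cis s = z" by blast
    have "{t. cis t = z} \<subseteq> range (\<lambda>n. s + real_of_int n * 2 * pi)"
    proof
      fix t assume "t \<in> {t. cis t = z}"
      then have "cis (t - s) = 1"
        using s z cis_divide[of t s] by auto
      then have "Re (cis (t - s)) = Re 1" by (rule arg_cong)
      then have "cos (t - s) = 1" by simp
      then obtain n where "t - s = real_of_int n * 2 * pi" using cos_one_2pi_int by blast
      then show "t \<in> range (\<lambda>n. s + real_of_int n * 2 * pi)" by (auto simp: algebra_simps image_iff)
    qed
    then show ?thesis by (rule countable_subset) simp
  qed simp
  then have "countable ?A" by (rule countable_subset[rotated]) auto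
  then have "emeasure lborel ?A = 0" by (rule emeasure_lborel_countable)
  moreover have "emeasure circle_lebesgue {z} = emeasure ?R ?A"
    unfolding circle_lebesgue_def by (rule emeasure_distr[OF cis sets])
  moreover have "emeasure ?R ?A = emeasure lborel ?A"
    by (rule emeasure_restrict_space) (auto simp: space_restrict_space)
  ultimately show "emeasure circle_lebesgue {z} = 0" by simp
qed

lemma borel_measurable_cnj: "g \<in> borel_measurable M \<Longrightarrow> (\<lambda>x. cnj (g x)) \<in> borel_measurable M"
  by (rule borel_measurable_continuous_on) (intro continuous_intros)

text \<open>
  The spectral theorem in use: \<open>K\<close> acts on \<open>H\<close> as multiplication by the coordinate of the circle,
  with \<open>f\<close> represented by the constant function one.
\<close>

locale multiplication_model = circle_measure \<nu> for \<nu> +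
  fixes H :: "'h::complex_inner set" and K :: "'h \<Rightarrow> 'h" and f :: 'h and \<phi> :: "'h \<Rightarrow> complex \<Rightarrow> complex"
  assumes subspace: "csubspace H"
    and invariant: "x \<in> H \<Longrightarrow> K x \<in> H"
    and f_in: "f \<in> H"
    and representation: "spectral_representation H K f \<nu> \<phi>"
begin

lemma iso: "L2_isomorphism H \<nu> \<phi>"
  and phi_f: "AE z in \<nu>. \<phi> f z = 1"
  and phi_K: "x \<in> H \<Longrightarrow> AE z in \<nu>. \<phi> (K x) z = z * \<phi> x z"
  using representation by (auto simp: spectral_representation_def)

lemma phi_add: "x \<in> H \<Longrightarrow> y \<in> H \<Longrightarrow> AE z in \<nu>. \<phi> (x + y) z = \<phi> x z + \<phi> y z"
  and phi_scale: "x \<in> H \<Longrightarrow> AE z in \<nu>. \<phi> (c *\<^sub>C x) z = c * \<phi> x z"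
  and phi_inner: "x \<in> H \<Longrightarrow> y \<in> H \<Longrightarrow> cinner x y = (\<integral>z. \<phi> x z * cnj (\<phi> y z) \<partial>\<nu>)"
  and phi_surj: "g \<in> L2_functions \<nu> \<Longrightarrow> \<exists>x\<in>H. AE z in \<nu>. \<phi> x z = g z"
  and phi_measurable [measurable]: "x \<in> H \<Longrightarrow> \<phi> x \<in> borel_measurable \<nu>"
  using iso by (auto simp: L2_isomorphism_def L2_functions_def)

lemma phi_zero_imp:
  assumes "x \<in> H" "AE z in \<nu>. \<phi> x z = 0"
  shows "x = 0"
proof -
  have "cinner x x = (\<integral>z. 0 \<partial>\<nu>)"
    unfolding phi_inner[OF assms(1) assms(1)]
    by (rule integral_cong_AE) (use assms in \<open>auto intro!: borel_measurable_times borel_measurable_cnj phi_measurable\<close>)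
  then show ?thesis by (simp add: cinner_self)
qed

lemma power_in: "(K ^^ k) f \<in> H"
  by (induction k) (auto simp: f_in invariant)

lemma phi_power: "AE z in \<nu>. \<phi> ((K ^^ k) f) z = z ^ k"
proof (induction k)
  case 0
  then show ?case using phi_f by simp
next
  case (Suc k)
  from phi_K[OF power_in[of k]] Suc show ?case
    by eventually_elim simp
qed

lemma cinner_powers: "cinner ((K ^^ j) f) ((K ^^ k) f) = fourier j k"
proof -
  have "(\<lambda>z. z ^ j * cnj (z ^ k)) \<in> borel_measurable \<nu>"
    by (rule borel_measurable_circle) (intro borel_measurable_continuous_onI continuous_intros)
  moreover have "AE z in \<nu>. \<phi> ((K ^^ j) f) z * cnj (\<phi> ((K ^^ k) f) z) = z ^ j * cnj (z ^ k)"
    using phi_power[of j] phi_power[of k] by eventually_elim simp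
  moreover have "(\<lambda>z. \<phi> ((K ^^ j) f) z * cnj (\<phi> ((K ^^ k) f) z)) \<in> borel_measurable \<nu>"
    by (intro borel_measurable_times borel_measurable_cnj phi_measurable power_in)
  ultimately show ?thesis
    unfolding phi_inner[OF power_in power_in] fourier_def by (intro integral_cong_AE)
qed

text \<open>
  Multiplication by \<open>t\<close> and by \<open>z\<close> agree on \<open>\<phi> x\<close>, so \<open>\<phi> x\<close> is concentrated at the point \<open>z\<close>.
\<close>

lemma eigenvector_support:
  assumes "x \<in> H" "K x = z *\<^sub>C x"
  shows "AE t in \<nu>. t \<noteq> z \<longrightarrow> \<phi> x t = 0"
  using phi_K[OF assms(1)] phi_scale[OF assms(1), of z] unfolding assms(2)
  by eventually_elim auto

lemma cinner_eigenvector: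
  assumes y: "y \<in> H" and x: "x \<in> H" "K x = z *\<^sub>C x"
  shows "cinner y x = \<phi> y z * cnj (\<phi> x z) * of_real (measure \<nu> {z})"
proof -
  have "AE t in \<nu>. \<phi> y t * cnj (\<phi> x t) = \<phi> y z * cnj (\<phi> x z) * indicator {z} t"
    using eigenvector_support[OF x] by eventually_elim (auto simp: indicator_def)
  moreover have "(\<lambda>t. \<phi> y z * cnj (\<phi> x z) * indicator {z} t) \<in> borel_measurable \<nu>"
    by (intro borel_measurable_times borel_measurable_const borel_measurable_circle) simp
  moreover have "(\<lambda>t. \<phi> y t * cnj (\<phi> x t)) \<in> borel_measurable \<nu>"
    by (intro borel_measurable_times borel_measurable_cnj phi_measurable y x(1))
  ultimately have "cinner y x = (\<integral>t. \<phi> y z * cnj (\<phi> x z) * indicator {z} t \<partial>\<nu>)"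
    unfolding phi_inner[OF y x(1)] by (intro integral_cong_AE)
  then show ?thesis unfolding integral_indicator_singleton .
qed

lemma eigenvectors_orthogonal:
  assumes y: "y \<in> H" "K y = z' *\<^sub>C y" and x: "x \<in> H" "K x = z *\<^sub>C x" and ne: "z \<noteq> z'"
  shows "cinner y x = 0"
proof (cases "measure \<nu> {z} = 0")
  case False
  then have "\<phi> y z = 0"
    using AE_atom[OF eigenvector_support[OF y]] ne by blast
  then show ?thesis unfolding cinner_eigenvector[OF y(1) x] by simp
qed (simp add: cinner_eigenvector[OF y(1) x])

lemma unit_eigenvector_density:
  assumes x: "x \<in> H" "K x = z *\<^sub>C x" and unit: "norm x = 1"
  shows "(cmod (\<phi> x z))\<^sup>2 * measure \<nu> {z} = 1"
proof -
  have "complex_of_real ((cmod (\<phi> x z))\<^sup>2 * measure \<nu> {z}) = cinner x x"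
    unfolding cinner_eigenvector[OF x(1) x] of_real_mult complex_norm_square ..
  also have "\<dots> = complex_of_real 1"
    by (simp add: cinner_self unit)
  finally show ?thesis unfolding of_real_eq_iff .
qed

lemma unit_eigenvector_atom:
  assumes "x \<in> H" "K x = z *\<^sub>C x" "norm x = 1"
  shows "measure \<nu> {z} \<noteq> 0"
  using unit_eigenvector_density[OF assms] by auto

text \<open>
  The orbit of \<open>f\<close> is represented by the functions \<open>z\<^sup>k\<close>, whose modulus at the eigenvalue is one; hence
  the correlation with a unit eigenvector has the same modulus at all times, and the square of this
  modulus is the mass of the atom.
\<close>

lemma cinner_power_unit_eigenvector:
  assumes x: "x \<in> H" "K x = z *\<^sub>C x" "norm x = 1"
  shows "(cmod (cinner ((K ^^ k) f) x))\<^sup>2 = measure \<nu> {z}"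
proof -
  note atom = unit_eigenvector_atom[OF x]
  have "\<phi> ((K ^^ k) f) z = z ^ k"
    using AE_atom[OF phi_power atom] .
  moreover have "cmod z = 1" using atom_on_circle[OF atom] by simp
  ultimately have "(cmod (cinner ((K ^^ k) f) x))\<^sup>2 = ((cmod (\<phi> x z))\<^sup>2 * measure \<nu> {z}) * measure \<nu> {z}"
    unfolding cinner_eigenvector[OF power_in x(1,2)]
    by (simp add: norm_mult norm_power power_mult_distrib power2_eq_square)
  then show ?thesis unfolding unit_eigenvector_density[OF x] by simp
qed

text \<open>
  The eigenvector is the one represented by the indicator function of the atom.
\<close>

lemma atom_is_eigenvalue:
  assumes atom: "measure \<nu> {z} \<noteq> 0"
  shows "\<exists>x\<in>H. x \<noteq> 0 \<and> K x = z *\<^sub>C x"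
proof -
  have meas: "(indicator {z} :: complex \<Rightarrow> complex) \<in> borel_measurable \<nu>"
    by (rule borel_measurable_circle) simp
  have sq: "(cmod (indicator {z} t))\<^sup>2 = (indicator {z} t :: real)" for t
    by (simp add: indicator_def)
  have "integrable \<nu> (indicator {z} :: complex \<Rightarrow> real)"
  proof (rule integrable_const_bound[where B = 1])
    show "(indicator {z} :: complex \<Rightarrow> real) \<in> borel_measurable \<nu>"
      by (rule borel_measurable_circle) simp
  qed (simp add: indicator_def)
  then have "integrable \<nu> (\<lambda>t. (cmod (indicator {z} t))\<^sup>2)"
    unfolding sq by simp
  with meas have "indicator {z} \<in> L2_functions \<nu>"
    unfolding L2_functions_def by blast
  then obtain x where x: "x \<in> H" "AE t in \<nu>. \<phi> x t = indicator {z} t"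
    using phi_surj by blast
  have zx: "(- z) *\<^sub>C x \<in> H"
    using subspace x(1) by (rule complex_vector.subspace_scale)
  have Kx: "K x \<in> H" using x(1) by (rule invariant)
  have "AE t in \<nu>. \<phi> (K x + (- z) *\<^sub>C x) t = 0"
    using phi_add[OF Kx zx] phi_K[OF x(1)] phi_scale[OF x(1), of "- z"] x(2)
    by eventually_elim (auto simp: indicator_def)
  then have "K x + (- z) *\<^sub>C x = 0"
    using subspace Kx zx by (intro phi_zero_imp complex_vector.subspace_add)
  then have eq: "K x = z *\<^sub>C x"
    by (simp add: complex_vector.scale_minus_left)
  have "\<phi> x z = 1" using AE_atom[OF x(2) atom] by simp
  then have "cinner x x \<noteq> 0"
    unfolding cinner_eigenvector[OF x(1) x(1) eq] using atom by simp
  then have "x \<noteq> 0" by auto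
  then show ?thesis using x(1) eq by blast
qed

end

text \<open>
  The singular continuous and the absolutely continuous part have no atoms.
\<close>

lemma lebesgue_decomposition_atom:
  assumes dec: "lebesgue_decomposition \<nu> \<nu>_d \<nu>_sc \<nu>_ac"
    and z: "{z} \<in> sets \<nu>" "z \<in> sphere 0 1" and atom: "emeasure \<nu> {z} \<noteq> 0"
  shows "emeasure \<nu>_d {z} \<noteq> 0"
proof -
  have "emeasure \<nu> {z} = emeasure \<nu>_d {z} + emeasure \<nu>_sc {z} + emeasure \<nu>_ac {z}"
    and "emeasure \<nu>_sc {z} = 0" and ac: "absolutely_continuous circle_lebesgue \<nu>_ac"
    using dec z by (auto simp: lebesgue_decomposition_def singular_continuous_measure_def)
  moreover have "emeasure \<nu>_ac {z} = 0"
    using ac circle_lebesgue_singleton[OF z(2)] by (auto simp: absolutely_continuous_def)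
  ultimately show ?thesis using atom by auto
qed

text \<open>
  The component in the completely non unitary part satisfies the same eigenvalue equation.  If it
  were nonzero, its eigenvalue would have modulus one because \<open>K\<close> is isometric, and the powers of \<open>K\<close>
  could not be weakly null on it.
\<close>

lemma eigenvector_in_unitary_part:
  assumes wold: "wold_decomposition H K H_NU H_U" and iso: "isometry_on H_NU K"
    and add: "\<And>x y. x \<in> H \<Longrightarrow> y \<in> H \<Longrightarrow> K (x + y) = K x + K y"
    and x: "x \<in> H" "K x = z *\<^sub>C x"
  shows "x \<in> H_U"
proof -
  interpret isometry_on H_NU K by fact
  have sub_U: "csubspace H_U" and orth: "Defs.corthogonal H_NU H_U" and shifts: "sum_of_unilateral_shifts_on H_NU K"
    and H: "H = {x + y | x y. x \<in> H_NU \<and> y \<in> H_U}" and K_U: "K ` H_U \<subseteq> H_U"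
    using wold by (auto simp: wold_decomposition_def closed_csubspace_def)
  obtain p q where pq: "x = p + q" "p \<in> H_NU" "q \<in> H_U" using x(1) unfolding H by blast
  have "p \<in> H" using pq complex_vector.subspace_0[OF sub_U] unfolding H by force
  moreover have "q \<in> H" using pq complex_vector.subspace_0[OF subspace] unfolding H by force
  ultimately have "K p + K q = z *\<^sub>C p + z *\<^sub>C q"
    using add[of p q] x(2) pq(1) by (simp add: scaleC_add_right)
  then have eq: "K p - z *\<^sub>C p = z *\<^sub>C q - K q"
    by (simp add: algebra_simps)
  have "K p - z *\<^sub>C p \<in> H_NU"
    using pq subspace invariant by (intro complex_vector.subspace_diff complex_vector.subspace_scale) auto
  moreover have "K p - z *\<^sub>C p \<in> H_U"
    unfolding eq using pq sub_U K_U by (intro complex_vector.subspace_diff complex_vector.subspace_scale) auto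
  ultimately have "cinner (K p - z *\<^sub>C p) (K p - z *\<^sub>C p) = 0"
    using orth unfolding Defs.corthogonal_def by blast
  then have Kp: "K p = z *\<^sub>C p" by (simp add: cinner_self)
  have "p = 0"
  proof (rule ccontr)
    assume "p \<noteq> 0"
    have "cmod z * norm p = norm p"
      using power_norm[OF pq(2), of 1] by (simp add: Kp norm_scaleC)
    then have z1: "cmod z = 1" using \<open>p \<noteq> 0\<close> by simp
    have "(K ^^ r) p = z ^ r *\<^sub>C p" for r
      by (induction r) (simp_all add: map_scale[OF pq(2)] Kp scaleC_scaleC mult.commute)
    then have "cmod (cinner ((K ^^ r) p) p) = (norm p)\<^sup>2" for r
      by (simp add: hilbert.ip_scale_left norm_mult norm_power z1 cinner_self)
    moreover have "(\<lambda>r. cmod (cinner ((K ^^ r) p) p)) \<longlonglongrightarrow> 0"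
      using unilateral_shifts_weakly_null[OF iso shifts pq(2) pq(2)] by (rule tendsto_norm_zero)
    ultimately show False using \<open>p \<noteq> 0\<close> by (simp add: LIMSEQ_const_iff)
  qed
  then show ?thesis using pq by simp
qed

section \<open>Gram matrices of a time series\<close>

lemma shifted_in_shift_span: "shifted f i \<in> shift_span f"
proof -
  have "shifted f i = (\<lambda>k. \<Sum>l\<le>i. (if l = i then 1 else 0) * shifted f l k)"
    by (simp add: if_distrib[of "\<lambda>c. c * _"] cong: if_cong)
  then show ?thesis
    unfolding shift_span_def by (intro CollectI exI[of _ i] exI[of _ "\<lambda>l. if l = i then 1 else 0"])
qed

text \<open>
  The sum in the definition of the Gram matrix has \<open>M + 1\<close> terms but is divided by \<open>M\<close>; the factor
  \<open>(M + 1) / M\<close> does not change the limit.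
\<close>

lemma gram_matrix_limit:
  assumes "completion_map f \<iota>" "i \<le> N" "j \<le> N"
  shows "(\<lambda>M. gram_matrix f N M $$ (i, j)) \<longlonglongrightarrow> cinner (\<iota> (shifted f i)) (\<iota> (shifted f j))"
proof -
  let ?c = "cinner (\<iota> (shifted f i)) (\<iota> (shifted f j))"
  have "(\<lambda>n. (\<Sum>k<n. shifted f i k * cnj (shifted f j k)) / of_nat n) \<longlonglongrightarrow> ?c"
    using assms(1) shifted_in_shift_span unfolding completion_map_def by blast
  from LIMSEQ_Suc[OF this]
  have "(\<lambda>M. (\<Sum>t\<le>M. f (i + t) * cnj (f (j + t))) / of_nat (Suc M)) \<longlonglongrightarrow> ?c"
    by (simp add: shifted_def lessThan_Suc_atMost del: of_nat_Suc sum.lessThan_Suc)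
  moreover have "(\<lambda>M. of_nat (Suc M) / of_nat M :: complex) \<longlonglongrightarrow> 1"
    by (rule LIMSEQ_Suc_n_over_n)
  ultimately have "(\<lambda>M. (\<Sum>t\<le>M. f (i + t) * cnj (f (j + t))) / of_nat (Suc M) * (of_nat (Suc M) / of_nat M)) \<longlonglongrightarrow> ?c * 1"
    by (rule tendsto_mult)
  then show ?thesis
    using assms by (simp add: gram_matrix_def del: of_nat_Suc)
qed

lemma gram_matrix_hermitian:
  assumes "k \<le> N" "l \<le> N"
  shows "gram_matrix f N M $$ (k, l) = cnj (gram_matrix f N M $$ (l, k))"
  using assms by (simp add: gram_matrix_def mult.commute)

lemma gram_diagonalization:
  fixes g :: "nat \<Rightarrow> 'h::complex_inner"
  shows "\<exists>e u. antimono_on {..N} e \<and> (\<forall>i\<le>N. 0 \<le> e i) \<and>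
    unitarily_diagonalizes (Suc N) (\<lambda>k l. cinner (g k) (g l)) e u"
proof -
  define A where "A = mat (Suc N) (Suc N) (\<lambda>(k, l). cinner (g k) (g l))"
  have A: "A $$ (k, l) = cinner (g k) (g l)" if "k < Suc N" "l < Suc N" for k l
    using that by (simp add: A_def)
  have "\<exists>e u. antimono_on {..<Suc N} e \<and> (\<forall>i<Suc N. 0 \<le> e i) \<and>
      unitarily_diagonalizes (Suc N) (\<lambda>k l. A $$ (k, l)) e u"
  proof (rule positive_semidefinite_diagonalization)
    show "A \<in> carrier_mat (Suc N) (Suc N)" by (simp add: A_def)
    show "A $$ (k, l) = cnj (A $$ (l, k))" if "k < Suc N" "l < Suc N" for k l
      using cinner_commute[of "g k" "g l"] by (simp add: A that)
    fix x :: "nat \<Rightarrow> complex"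
    let ?z = "\<Sum>k<Suc N. cnj (x k) *\<^sub>C g k"
    have "(\<Sum>k<Suc N. \<Sum>l<Suc N. A $$ (k, l) * x l * cnj (x k)) = cinner ?z ?z"
      unfolding hilbert.ip_sum_left hilbert.ip_scale_left hilbert.ip_sum_right hilbert.ip_scale_right
      unfolding sum_distrib_left by (subst sum.swap, intro sum.cong refl) (simp add: A)
    then show "0 \<le> Re (\<Sum>k<Suc N. \<Sum>l<Suc N. A $$ (k, l) * x l * cnj (x k))"
      using hilbert.ip_self_nonneg[of ?z] by simp
  qed
  then obtain e u where eu: "antimono_on {..<Suc N} e" "\<forall>i<Suc N. 0 \<le> e i"
      "unitarily_diagonalizes (Suc N) (\<lambda>k l. A $$ (k, l)) e u"
    by blast
  have "cinner (g k) (g l) = (\<Sum>i<Suc N. of_real (e i) * u i k * cnj (u i l))"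
    if kl: "k < Suc N" "l < Suc N" for k l
  proof -
    have "A $$ (k, l) = (\<Sum>i<Suc N. of_real (e i) * u i k * cnj (u i l))"
      using eu(3) kl unfolding unitarily_diagonalizes_def by blast
    then show ?thesis unfolding A[OF kl] .
  qed
  then have "unitarily_diagonalizes (Suc N) (\<lambda>k l. cinner (g k) (g l)) e u"
    using eu(3) unfolding unitarily_diagonalizes_def by blast
  with eu(1,2) show ?thesis
    unfolding lessThan_Suc_atMost less_Suc_eq_le by blast
qed

text \<open>
  By Weyl's inequality the ordered eigenvalues inherit the convergence of the entries.
\<close>

lemma gram_matrix_eigenvalue_limit:
  assumes completion: "completion_map f \<iota>"
    and d: "\<And>M. eigenvalues_decreasing (gram_matrix f N M) (d M)"
    and e: "unitarily_diagonalizes (Suc N) (\<lambda>k l. cinner (\<iota> (shifted f k)) (\<iota> (shifted f l))) e u"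
      "antimono_on {..N} e" "\<And>i. i \<le> N \<Longrightarrow> 0 \<le> e i"
    and i: "i \<le> N"
  shows "(\<lambda>M. d M i) \<longlonglongrightarrow> e i"
proof -
  let ?G = "\<lambda>k l. cinner (\<iota> (shifted f k)) (\<iota> (shifted f l))"
  define \<eta> where "\<eta> M = (\<Sum>k<Suc N. \<Sum>l<Suc N. cmod (gram_matrix f N M $$ (k, l) - ?G k l))" for M
  have "(\<lambda>M. cmod (gram_matrix f N M $$ (k, l) - ?G k l)) \<longlonglongrightarrow> 0" if "k < Suc N" "l < Suc N" for k l
    using gram_matrix_limit[OF completion, of k N l] that
    by (intro tendsto_norm_zero LIM_zero) simp
  then have "\<eta> \<longlonglongrightarrow> (\<Sum>k<Suc N. \<Sum>l<Suc N. 0)"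
    unfolding \<eta>_def[abs_def] by (intro tendsto_sum) auto
  then have \<eta>: "\<eta> \<longlonglongrightarrow> 0" by simp
  have "\<bar>d M i - e i\<bar> \<le> \<eta> M" for M
  proof -
    have dim: "dim_row (gram_matrix f N M) = Suc N" by (simp add: gram_matrix_def)
    have dM: "antimono_on {..<Suc N} (d M)" "\<And>i. i < Suc N \<Longrightarrow> 0 \<le> d M i"
      using d[of M] by (auto simp: eigenvalues_decreasing_def dim)
    have "\<exists>v. unitarily_diagonalizes (Suc N) (\<lambda>k l. gram_matrix f N M $$ (k, l)) (d M) v"
    proof (rule eigenvalues_decreasing_diagonalizes)
      show "gram_matrix f N M \<in> carrier_mat (Suc N) (Suc N)" by (simp add: gram_matrix_def)
      show "gram_matrix f N M $$ (k, l) = cnj (gram_matrix f N M $$ (l, k))" if "k < Suc N" "l < Suc N" for k l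
        by (rule gram_matrix_hermitian) (use that in auto)
    qed (rule d)
    then obtain v where v: "unitarily_diagonalizes (Suc N) (\<lambda>k l. gram_matrix f N M $$ (k, l)) (d M) v"
      by blast
    have e': "antimono_on {..<Suc N} e" "\<And>i. i < Suc N \<Longrightarrow> 0 \<le> e i"
      using e by (auto simp: lessThan_Suc_atMost)
    have iN: "i < Suc N" using i by simp
    have "d M i \<le> e i + \<eta> M"
      unfolding \<eta>_def by (rule eigenvalue_perturbation[OF v dM e(1) e' iN])
    moreover have "e i \<le> d M i + \<eta> M"
    proof -
      have "\<eta> M = (\<Sum>k<Suc N. \<Sum>l<Suc N. cmod (?G k l - gram_matrix f N M $$ (k, l)))"
        unfolding \<eta>_def by (intro sum.cong refl norm_minus_commute)
      moreover have "e i \<le> d M i + \<dots>"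
        by (rule eigenvalue_perturbation[OF e(1) e' v dM iN])
      ultimately show ?thesis by (simp only:)
    qed
    ultimately show ?thesis by linarith
  qed
  then have "(\<lambda>M. d M i - e i) \<longlonglongrightarrow> 0"
    using \<eta> by (intro Lim_null_comparison[OF _ \<eta>] always_eventually) auto
  then show ?thesis by (rule LIM_zero_cancel)
qed

section \<open>Asymptotics of the Gram eigenvalues\<close>

theorem theorem4:
  fixes f :: "nat \<Rightarrow> complex"
    and \<iota> :: "(nat \<Rightarrow> complex) \<Rightarrow> 'h::{complex_inner, complete_space}"
    and K :: "'h \<Rightarrow> 'h"
    and H_NU H_U :: "'h set"
    and f_NU f_U f_d f_sc f_ac :: 'h
    and n :: enat
    and v :: "nat \<Rightarrow> 'h"
    and a :: "nat \<Rightarrow> complex"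
    and d :: "nat \<Rightarrow> nat \<Rightarrow> nat \<Rightarrow> real"
  assumes autocovariance: "\<And>s. autocovariance_exists f s"
    and completion: "completion_map f \<iota>"
    and shift: "time_shift f \<iota> K"
    and wold: "wold_decomposition (series_space f \<iota>) K H_NU H_U"
    and f_parts: "\<iota> (shifted f 0) = f_NU + f_U" "f_NU \<in> H_NU" "f_U \<in> H_U"
    and f_U_parts: "spectral_splitting H_U K f_U f_d f_sc f_ac"
    and eigenvectors: "eigenvector_enumeration (series_space f \<iota>) K n v"
    and coefficients: "(\<lambda>i. a i *\<^sub>C v i) sums f_d" "\<And>i. \<not> enat i < n \<Longrightarrow> a i = 0"
    and coefficients_decreasing: "antimono (\<lambda>i. cmod (a i))"
    and gram_eigenvalues: "\<And>N M. eigenvalues_decreasing (gram_matrix f N M) (d N M)"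
  shows "\<forall>i. \<exists>L. (\<forall>N\<ge>i. (\<lambda>M. d N M i / real N) \<longlonglongrightarrow> L N) \<and> L \<longlonglongrightarrow> (cmod (a i))\<^sup>2"
proof -
  let ?H = "series_space f \<iota>"
  define g where "g k = \<iota> (shifted f k)" for k
  have g0: "g 0 = f_NU + f_U" using f_parts(1) by (simp add: g_def)

  have sub_NU: "csubspace H_NU" and sub_U: "csubspace H_U" and orth: "Defs.corthogonal H_NU H_U"
    and H_eq: "?H = {x + y | x y. x \<in> H_NU \<and> y \<in> H_U}"
    and K_NU: "\<And>x. x \<in> H_NU \<Longrightarrow> K x \<in> H_NU" and K_U: "\<And>x. x \<in> H_U \<Longrightarrow> K x \<in> H_U"
    and shifts: "sum_of_unilateral_shifts_on H_NU K"
    using wold by (auto simp: wold_decomposition_def closed_csubspace_def)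
  have NU_H: "x \<in> ?H" if "x \<in> H_NU" for x
    using that complex_vector.subspace_0[OF sub_U] unfolding H_eq by force
  have U_H: "x \<in> ?H" if "x \<in> H_U" for x
    using that complex_vector.subspace_0[OF sub_NU] unfolding H_eq by force
  have NU_U: "cinner x y = 0" "cinner y x = 0" if "x \<in> H_NU" "y \<in> H_U" for x y
    using orth that cinner_commute[of y x] by (auto simp: Defs.corthogonal_def)
  have K_add: "\<And>x y. x \<in> ?H \<Longrightarrow> y \<in> ?H \<Longrightarrow> K (x + y) = K x + K y"
    and K_scale: "\<And>c x. x \<in> ?H \<Longrightarrow> K (c *\<^sub>C x) = c *\<^sub>C K x"
    and K_cont: "continuous_on ?H K"
    and K_shifted: "\<And>k. K (g k) = g (Suc k)"
    using shift unfolding time_shift_def g_def by blast+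
  have iso: "isometry_on H_NU K"
  proof (rule unilateral_shifts_isometry_on[OF shifts sub_NU])
    show "continuous_on H_NU K"
      using K_cont by (rule continuous_on_subset) (use NU_H in blast)
  qed (use K_NU K_add K_scale NU_H in auto)
  interpret NU: isometry_on H_NU K by (rule iso)

  obtain \<nu> \<nu>_d \<nu>_sc \<nu>_ac \<phi> where rep: "spectral_representation H_U K f_U \<nu> \<phi>"
    and dec: "lebesgue_decomposition \<nu> \<nu>_d \<nu>_sc \<nu>_ac" and f_U_sum: "f_U = f_d + f_sc + f_ac"
    and f_d: "f_d \<in> spectral_component H_U \<phi> \<nu>_sc \<nu>_ac"
    and f_sc: "f_sc \<in> spectral_component H_U \<phi> \<nu>_d \<nu>_ac"
    and f_ac: "f_ac \<in> spectral_component H_U \<phi> \<nu>_d \<nu>_sc"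
    using f_U_parts unfolding spectral_splitting_def by blast
  interpret model: multiplication_model \<nu> H_U K f_U \<phi>
  proof (intro multiplication_model.intro circle_measure.intro multiplication_model_axioms.intro
      circle_measure_axioms.intro)
    show "finite_measure \<nu>" "sets \<nu> = sets circle_borel"
      using rep by (auto simp: spectral_representation_def)
  qed (use sub_U K_U f_parts rep in auto)

  have g_split: "g k = (K ^^ k) f_NU + (K ^^ k) f_U" for k
  proof (induction k)
    case (Suc k)
    have "g (Suc k) = K ((K ^^ k) f_NU + (K ^^ k) f_U)"
      using Suc K_shifted[of k] by simp
    also have "\<dots> = K ((K ^^ k) f_NU) + K ((K ^^ k) f_U)"
      by (rule K_add) (use NU_H U_H NU.power_invariant model.power_in f_parts in auto)
    finally show ?case by simp
  qed (simp add: g0)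
  have NU_in: "(K ^^ k) f_NU \<in> H_NU" for k
    using f_parts(2) by (rule NU.power_invariant)
  define b where "b j k = cinner ((K ^^ j) f_NU) ((K ^^ k) f_NU)" for j k
  have gg: "cinner (g j) (g k) = model.fourier j k + b j k" for j k
    unfolding g_split b_def model.cinner_powers[symmetric]
    by (simp add: hilbert.ip_add_left hilbert.ip_add_right NU_U[OF NU_in model.power_in])
  have mean: "(\<lambda>N. (\<Sum>j\<le>N. \<Sum>k\<le>N. (cmod (cinner (g j) (g k)))\<^sup>2) / (real (Suc N))\<^sup>2)
      \<longlonglongrightarrow> (\<integral>w. measure \<nu> {w} \<partial>\<nu>)"
    \<comment> \<open>the completely non unitary part adds the correlations \<open>b\<close>, which vanish in the mean\<close>
    unfolding gg
  proof (rule mean_square_perturbation)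
    let ?C = "max (measure \<nu> (space \<nu>)) ((norm f_NU)\<^sup>2)"
    show "cmod (model.fourier j k) \<le> ?C" for j k
      using model.norm_fourier_le[of j k] by simp
    show "cmod (b j k) \<le> ?C" for j k
      unfolding b_def using cmod_cinner_le[of "(K ^^ j) f_NU" "(K ^^ k) f_NU"]
      by (simp add: NU.power_norm[OF f_parts(2)] power2_eq_square)
    show "(\<lambda>N. (\<Sum>j\<le>N. \<Sum>k\<le>N. (cmod (model.fourier j k))\<^sup>2) / (real (Suc N))\<^sup>2)
        \<longlonglongrightarrow> (\<integral>w. measure \<nu> {w} \<partial>\<nu>)"
      by (rule model.wiener_mean_square)
    have "(\<lambda>r. cmod (cinner ((K ^^ r) f_NU) f_NU)) \<longlonglongrightarrow> 0"
      by (rule tendsto_norm_zero[OF unilateral_shifts_weakly_null[OF iso shifts f_parts(2) f_parts(2)]])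
    then show "(\<lambda>N. (\<Sum>j\<le>N. \<Sum>k\<le>N. cmod (b j k)) / (real (Suc N))\<^sup>2) \<longlonglongrightarrow> 0"
      unfolding b_def NU.cinner_powers[OF f_parts(2)] by (rule toeplitz_mean_tendsto_zero) simp
  qed

  \<comment> \<open>all correlations of eigenvectors can be read off from the model once they are known to lie
    in \<open>H_U\<close>\<close>
  define A where "A = {i. enat i < n}"
  obtain ev where ev: "bij_betw ev A (point_spectrum ?H K)"
    and v_eig: "\<And>i. i \<in> A \<Longrightarrow> v i \<in> ?H \<and> norm (v i) = 1 \<and> K (v i) = ev i *\<^sub>C v i"
    using eigenvectors unfolding eigenvector_enumeration_def A_def by blast
  have v_U: "v i \<in> H_U" and v_norm: "norm (v i) = 1" and v_K: "K (v i) = ev i *\<^sub>C v i"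
    if "i \<in> A" for i
    using v_eig[OF that] eigenvector_in_unitary_part[OF wold iso K_add] by blast+
  have v_orth: "cinner (v i) (v j) = 0" if "i \<in> A" "j \<in> A" "i \<noteq> j" for i j
  proof (rule model.eigenvectors_orthogonal)
    show "ev j \<noteq> ev i"
      using ev that by (metis bij_betw_imp_inj_on inj_onD)
  qed (use that v_U v_K in auto)
  have a_zero: "a i = 0" if "i \<notin> A" for i
    using coefficients(2) that by (simp add: A_def)
  have a_coeff: "a m = cinner f_d (v m)" if m: "m \<in> A" for m
  proof -
    have "(\<lambda>i. cinner (a i *\<^sub>C v i) (v m)) sums cinner f_d (v m)"
      using bounded_bilinear.bounded_linear_left[OF bounded_bilinear_cinner] coefficients(1)
      by (rule bounded_linear.sums)
    moreover have "cinner (a i *\<^sub>C v i) (v m) = (if i = m then a m else 0)" for i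
      using v_orth[of i m] a_zero[of i] m v_norm[OF m]
      by (cases "i \<in> A") (auto simp: hilbert.ip_scale_left cinner_self)
    ultimately have "(\<lambda>i. if i = m then a m else 0) sums cinner f_d (v m)"
      by simp
    then show ?thesis using sums_single[of m "\<lambda>_. a m"] sums_unique2 by blast
  qed
  have singular_orth: "cinner y (v m) = 0"
    if "m \<in> A" "y \<in> H_U" "AE z in \<nu>_d. \<phi> y z = 0" for m y
  proof -
    have atom: "measure \<nu> {ev m} \<noteq> 0"
      using model.unit_eigenvector_atom v_U v_K v_norm that(1) by blast
    have circle: "ev m \<in> sphere 0 1" using atom by (rule model.atom_on_circle)
    have ne: "emeasure \<nu>_d {ev m} \<noteq> 0"
      using dec model.singleton_in_sets[OF circle] circle
      by (rule lebesgue_decomposition_atom) (use atom in \<open>simp add: model.emeasure_eq_measure\<close>)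
    have "{ev m} \<in> sets \<nu>_d"
      using dec model.singleton_in_sets[OF circle] by (simp add: lebesgue_decomposition_def)
    from AE_singleton[OF that(3) this ne] have "\<phi> y (ev m) = 0" .
    then show ?thesis
      using model.cinner_eigenvector[OF that(2) v_U[OF that(1)] v_K[OF that(1)]] by simp
  qed
  have f_U_v: "cinner f_U (v m) = a m" if m: "m \<in> A" for m
    using a_coeff[OF m] singular_orth[OF m, of f_sc] singular_orth[OF m, of f_ac] f_sc f_ac
    by (simp add: f_U_sum hilbert.ip_add_left spectral_component_def)
  have a_atom: "(cmod (a m))\<^sup>2 = measure \<nu> {ev m}" if m: "m \<in> A" for m
    using model.cinner_power_unit_eigenvector[OF v_U[OF m] v_K[OF m] v_norm[OF m], of 0] f_U_v[OF m] by simp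
  have g_v: "cmod (cinner (g k) (v m)) = cmod (a m)" if m: "m \<in> A" for k m
  proof -
    have "cinner (g k) (v m) = cinner ((K ^^ k) f_U) (v m)"
      by (simp add: g_split hilbert.ip_add_left NU_U[OF NU_in v_U[OF m]])
    then have "(cmod (cinner (g k) (v m)))\<^sup>2 = (cmod (a m))\<^sup>2"
      using model.cinner_power_unit_eigenvector[OF v_U[OF m] v_K[OF m] v_norm[OF m], of k] a_atom[OF m] by simp
    then show ?thesis by simp
  qed
  have atoms: "w \<in> ev ` A" if w: "measure \<nu> {w} \<noteq> 0" for w
  proof -
    obtain x where "x \<in> H_U" "x \<noteq> 0" "K x = w *\<^sub>C x"
      using model.atom_is_eigenvalue[OF w] by blast
    then have "w \<in> point_spectrum ?H K"
      using U_H unfolding point_spectrum_def by blast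
    then show ?thesis using ev by (simp add: bij_betw_def)
  qed

  \<comment> \<open>scaling by the coefficients turns the \<open>v m\<close> into an infinite orthogonal family that is
    defined also beyond \<open>n\<close>, where \<open>v m\<close> is arbitrary but \<open>a m = 0\<close>\<close>
  define w where "w m = a m *\<^sub>C v m" for m
  have w_norm: "norm (w m) = cmod (a m)" for m
    using v_norm[of m] a_zero[of m] by (cases "m \<in> A") (auto simp: w_def norm_scaleC)
  have w_orth: "cinner (w m) (w l) = 0" if "m \<noteq> l" for m l
    using v_orth[of m l] a_zero[of m] a_zero[of l] that
    by (cases "m \<in> A"; cases "l \<in> A") (auto simp: w_def hilbert.ip_scale_left hilbert.ip_scale_right)
  have w_inv: "cmod (cinner (g k) (w m)) = (norm (w m))\<^sup>2" for k m
    unfolding w_norm using g_v[of m k] a_zero[of m]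
    by (cases "m \<in> A") (auto simp: w_def hilbert.ip_scale_right norm_mult power2_eq_square)
  have "(\<lambda>m. if m \<in> A then (measure \<nu> {ev m})\<^sup>2 else 0) sums (\<integral>w. measure \<nu> {w} \<partial>\<nu>)"
    by (rule model.integral_atom_weights_sums[OF bij_betw_imp_inj_on[OF ev] atoms])
  moreover have "(if m \<in> A then (measure \<nu> {ev m})\<^sup>2 else 0) = norm (w m) ^ 4" for m
    using a_zero[of m] by (auto simp: w_norm a_atom[symmetric] simp flip: power_mult)
  ultimately have w_sums: "(\<lambda>m. norm (w m) ^ 4) sums (\<integral>w. measure \<nu> {w} \<partial>\<nu>)"
    by simp

  have "\<forall>N. \<exists>e u. antimono_on {..N} e \<and> (\<forall>i\<le>N. 0 \<le> e i) \<and>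
      unitarily_diagonalizes (Suc N) (\<lambda>k l. cinner (g k) (g l)) e u"
    using gram_diagonalization by blast
  then obtain e u where e_dec: "\<And>N. antimono_on {..N} (e N)" and e_nonneg: "\<And>N i. i \<le> N \<Longrightarrow> 0 \<le> e N i"
    and e_diag: "\<And>N. unitarily_diagonalizes (Suc N) (\<lambda>k l. cinner (g k) (g l)) (e N) (u N)"
    by metis
  have lim_N: "(\<lambda>N. e N i / real N) \<longlonglongrightarrow> (cmod (a i))\<^sup>2" for i
  proof -
    have "antimono (\<lambda>m. norm (w m))" unfolding w_norm by (rule coefficients_decreasing)
    from gram_eigenvalue_limit[OF w_orth this w_inv mean w_sums e_diag e_dec e_nonneg, of i]
    show ?thesis unfolding w_norm .
  qed
  have lim_M: "(\<lambda>M. d N M i / real N) \<longlonglongrightarrow> e N i / real N" if "i \<le> N" for i N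
  proof -
    have "(\<lambda>M. d N M i) \<longlonglongrightarrow> e N i"
      using completion gram_eigenvalues e_diag[of N, unfolded g_def] e_dec e_nonneg that
      by (rule gram_matrix_eigenvalue_limit)
    then have "(\<lambda>M. d N M i * inverse (real N)) \<longlonglongrightarrow> e N i * inverse (real N)"
      by (rule tendsto_mult_right)
    then show ?thesis by (simp add: divide_inverse)
  qed
  show ?thesis
  proof
    fix i
    show "\<exists>L. (\<forall>N\<ge>i. (\<lambda>M. d N M i / real N) \<longlonglongrightarrow> L N) \<and> L \<longlonglongrightarrow> (cmod (a i))\<^sup>2"
      using lim_N[of i] lim_M[of i] by (intro exI[of _ "\<lambda>N. e N i / real N"]) simp
  qed
qed

end
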